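(* Let $n\geq 3$ and $\tau$ be integers, and put $\sigma=n^{2}-\tau$. Suppose there is an integer $k\geq 1$ with $kn\leq\sigma\leq(k+1)n$, $\sigma-kn\equiv 0 \pmod{k+1}$ and $(k+1)n-\sigma\equiv 0\pmod{k}$. Then $$\mu(n,\tau)=((k+1)!)^{\frac{\sigma-kn}{k+1}}\times(k!)^{\frac{(k+1)n-\sigma}{k}}.$$ Moreover, for $A\in\mathscr{U}(n,\tau)$, ${\rm per}A=\mu(n,\tau)$ if and only if $A$ is combinatorially equivalent to the matrix $$K_{n,\sigma}=J_{k+1}\oplus J_{k+1}\oplus\cdots\oplus J_{k+1}\oplus J_{k}\oplus\cdots\oplus J_{k}\in\mathscr{U}(n,\tau),$$ the direct sum of $\frac{\sigma-kn}{k+1}$ copies of $J_{k+1}$ and $\frac{(k+1)n-\sigma}{k}$ copies of $J_k$.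
   Context: For an $n\times n$ matrix $M=[a_{ij}]$, ${\rm per}M=\sum_{\phi}\prod_{i=1}^{n}a_{i\phi(i)}$, the sum over all permutations $\phi$ of $\{1,\dots,n\}$. $\mathscr{U}(n,\tau)$ is the set of all $(0,1)$-matrices of order $n$ with exactly $\tau$ entries equal to $0$ (hence exactly $\sigma=n^2-\tau$ entries equal to $1$), and $\mu(n,\tau)=\max\{{\rm per}A: A\in\mathscr{U}(n,\tau)\}$. $J_m$ denotes the $m\times m$ all-ones matrix and $\oplus$ the direct sum of matrices. Two matrices $A,B$ are combinatorially equivalent if $B=PAQ$ for some permutation matrices $P,Q$. *)

theory Defs
  imports
    "HOL-Number_Theory.Cong"
    "HOL-Combinatorics.Permutations"
    "Jordan_Normal_Form.Matrix"
begin

(* Meant for square matrices; rows and columns are indexed from 0. *)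
definition permanent :: "'a::comm_semiring_1 mat \<Rightarrow> 'a" where
  "permanent M = (\<Sum>\<phi> | \<phi> permutes {0..<dim_row M}. \<Prod>i = 0..<dim_row M. M $$ (i, \<phi> i))"

(* The number of zeros is an arbitrary integer; the set is empty unless 0 <= t <= n^2. *)
definition zero_one_mats :: "nat \<Rightarrow> int \<Rightarrow> int mat set" where
  "zero_one_mats n \<tau> =
     {A \<in> carrier_mat n n. elements_mat A \<subseteq> {0, 1} \<and>
        int (card {(i, j). i < n \<and> j < n \<and> A $$ (i, j) = 0}) = \<tau>}"

(* Max is taken over a finite set, and is unspecified when that set is empty. *)
definition max_permanent :: "nat \<Rightarrow> int \<Rightarrow> int" where
  "max_permanent n \<tau> = Max (permanent ` zero_one_mats n \<tau>)"

definition all_ones_mat :: "nat \<Rightarrow> 'a::one mat" where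
  "all_ones_mat m = mat m m (\<lambda>_. 1)"

definition permutation_mat :: "nat \<Rightarrow> (nat \<Rightarrow> nat) \<Rightarrow> 'a::{zero, one} mat" where
  "permutation_mat n p = mat n n (\<lambda>(i, j). if j = p i then 1 else 0)"

definition is_permutation_mat :: "nat \<Rightarrow> 'a::{zero, one} mat \<Rightarrow> bool" where
  "is_permutation_mat n P \<longleftrightarrow> (\<exists>p. p permutes {0..<n} \<and> P = permutation_mat n p)"

definition comb_equivalent :: "'a::semiring_1 mat \<Rightarrow> 'a mat \<Rightarrow> bool" where
  "comb_equivalent A B \<longleftrightarrow>
     (\<exists>P Q. is_permutation_mat (dim_row A) P \<and> is_permutation_mat (dim_col A) Q \<and> B = P * A * Q)"

(* The integer k is an explicit argument, as both quotients depend on it; the quotients are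
   meant to be exact and nonnegative. *)
definition block_ones_mat :: "nat \<Rightarrow> int \<Rightarrow> nat \<Rightarrow> int mat" where
  "block_ones_mat n \<sigma> k =
     diag_block_mat
       (replicate (nat ((\<sigma> - int k * int n) div (int k + 1))) (all_ones_mat (k + 1)) @
        replicate (nat (((int k + 1) * int n - \<sigma>) div int k)) (all_ones_mat k))"

end

theory Submission
  imports Defs
begin

text \<open>
  Bregman's inequality bounds the number of perfect matchings of a bipartite graph with row degrees
  $r_i$ by $\prod_i (r_i!)^{1/r_i}$. In Schrijver's argument, $n P \ln P$ for $P$ the permanent is
  compared with the same quantity for the minors, and the gap in the inequality is a sum of
  nonnegative terms: one convexity defect of $x \ln x$ per row, and one Bregman gap of a minor per
  pair of a matching and a row. Hence equality forces every minor at a nonzero entry to be extremal;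
  by induction those minors have pairwise equal or disjoint rows, and then so does the whole matrix.
  Since $\ln(r!)/r$ is strictly concave, for a fixed number of ones the bound is largest
  exactly when all row sums lie in $\{k, k+1\}$. A matrix whose rows are pairwise equal or disjoint
  and which has a nonzero permanent is determined up to row and column permutations by the
  distribution of its row sums.
\<close>

section \<open>Bregman's inequality and its equality case\<close>

text \<open>\<open>A i\<close> holds the columns of the ones in row \<open>i\<close>, so the number
  of matchings is the permanent of the submatrix on \<open>R\<close> and \<open>C\<close>. A minor
  only shrinks \<open>R\<close> and \<open>C\<close> and keeps \<open>A\<close>, which suits
  induction; \<open>extensional\<close> makes each matching count once.\<close>

definition matchings :: "('a \<Rightarrow> 'b set) \<Rightarrow> 'a set \<Rightarrow> 'b set \<Rightarrow> ('a \<Rightarrow> 'b) set" where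
  "matchings A R C = {s \<in> extensional R. bij_betw s R C \<and> (\<forall>i\<in>R. s i \<in> A i)}"

lemma finite_matchings:
  assumes "finite R" "finite C"
  shows "finite (matchings A R C)"
proof (rule finite_subset)
  show "matchings A R C \<subseteq> R \<rightarrow>\<^sub>E C"
    by (auto simp: matchings_def PiE_def bij_betw_def)
  show "finite (R \<rightarrow>\<^sub>E C)"
    using assms by (auto intro: finite_PiE)
qed

text \<open>Deleting row \<open>i\<close> from a matching and putting it back are mutually inverse.
  This turns counts of matchings through one entry into permanents of minors.\<close>

lemma card_matchings_fixed:
  assumes "i \<in> R" "k \<in> C" "k \<in> A i"
  shows "card {s \<in> matchings A R C. s i = k} = card (matchings A (R - {i}) (C - {k}))"
proof (rule bij_betw_same_card[where f = "\<lambda>s. restrict s (R - {i})"],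
    rule bij_betw_byWitness[where f' = "\<lambda>t. t(i := k)"])
  show "\<forall>s\<in>{s \<in> matchings A R C. s i = k}. (restrict s (R - {i}))(i := k) = s"
    using assms by (auto simp: matchings_def fun_eq_iff extensional_def)
  show "\<forall>t\<in>matchings A (R - {i}) (C - {k}). restrict (t(i := k)) (R - {i}) = t"
    by (auto simp: matchings_def fun_eq_iff extensional_def)
  show "(\<lambda>s. restrict s (R - {i})) ` {s \<in> matchings A R C. s i = k}
      \<subseteq> matchings A (R - {i}) (C - {k})"
  proof (intro image_subsetI)
    fix s assume s: "s \<in> {s \<in> matchings A R C. s i = k}"
    then have "bij_betw s (R - {i}) (C - {k})"
      using assms by (auto simp: matchings_def bij_betw_def inj_on_def)
    moreover have "bij_betw (restrict s (R - {i})) (R - {i}) (C - {k}) = bij_betw s (R - {i}) (C - {k})"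
      by (rule bij_betw_cong) simp
    ultimately show "restrict s (R - {i}) \<in> matchings A (R - {i}) (C - {k})"
      using s by (auto simp: matchings_def)
  qed
  show "(\<lambda>t. t(i := k)) ` matchings A (R - {i}) (C - {k}) \<subseteq> {s \<in> matchings A R C. s i = k}"
  proof (intro image_subsetI)
    fix t assume t: "t \<in> matchings A (R - {i}) (C - {k})"
    then have b: "bij_betw t (R - {i}) (C - {k})" by (simp add: matchings_def)
    have "bij_betw (t(i := k)) (insert i (R - {i})) (insert k (C - {k}))"
      using b by (subst bij_betw_def) (auto simp: bij_betw_def inj_on_def)
    then have "bij_betw (t(i := k)) R C"
      using assms by (simp add: insert_absorb)
    then show "t(i := k) \<in> {s \<in> matchings A R C. s i = k}"
      using t assms by (auto simp: matchings_def extensional_def)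
  qed
qed

text \<open>The junk value at \<open>r = 0\<close> is \<open>0\<close>, so that \<open>r * log_root_fact r = ln (fact r)\<close> for all
  \<open>r\<close>.\<close>
definition log_root_fact :: "nat \<Rightarrow> real" where
  "log_root_fact r = ln (fact r) / r"

lemma mult_log_root_fact: "real r * log_root_fact r = ln (fact r)"
  by (cases "r = 0") (auto simp: log_root_fact_def)

lemma sum_matchings_at:
  fixes g :: "'b \<Rightarrow> real"
  assumes "finite R" "finite C" "i \<in> R"
  shows "(\<Sum>s\<in>matchings A R C. g (s i))
    = (\<Sum>k\<in>A i \<inter> C. card {s \<in> matchings A R C. s i = k} * g k)"
proof -
  have "(\<Sum>s\<in>matchings A R C. g (s i))
      = (\<Sum>k\<in>A i \<inter> C. \<Sum>s | s \<in> matchings A R C \<and> s i = k. g (s i))"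
    by (rule sum.group[symmetric])
      (use assms in \<open>auto simp: finite_matchings\<close>, auto simp: matchings_def bij_betw_def)
  also have "\<dots> = (\<Sum>k\<in>A i \<inter> C. card {s \<in> matchings A R C. s i = k} * g k)"
    by (intro sum.cong refl) simp
  finally show ?thesis .
qed

text \<open>Swap the sums and fix \<open>j\<close>, with \<open>r\<close> ones in its row. As
  \<open>i\<close> runs over the other rows, \<open>s i\<close> runs over the columns other than
  \<open>s j\<close>: \<open>r - 1\<close> of them meet row \<open>j\<close> and shrink it to
  \<open>r - 1\<close> ones, the remaining \<open>card R - r\<close> leave it alone.\<close>

lemma sum_log_root_fact_minors:
  assumes "finite R" "finite C" "s \<in> matchings A R C"
  shows "(\<Sum>i\<in>R. \<Sum>j\<in>R - {i}. log_root_fact (card (A j \<inter> (C - {s i}))))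
    = (\<Sum>j\<in>R. card R * log_root_fact (card (A j \<inter> C)) - ln (card (A j \<inter> C)))"
proof -
  have bij: "bij_betw s R C" and sA: "\<And>i. i \<in> R \<Longrightarrow> s i \<in> A i"
    using assms by (auto simp: matchings_def)
  have "(\<Sum>i\<in>R. \<Sum>j\<in>R - {i}. log_root_fact (card (A j \<inter> (C - {s i}))))
      = (\<Sum>j\<in>R. \<Sum>i\<in>R - {j}. log_root_fact (card (A j \<inter> (C - {s i}))))"
  proof -
    have "(\<Sum>i\<in>R. \<Sum>j | j \<in> R \<and> i \<noteq> j. log_root_fact (card (A j \<inter> (C - {s i}))))
      = (\<Sum>j\<in>R. \<Sum>i | i \<in> R \<and> i \<noteq> j. log_root_fact (card (A j \<inter> (C - {s i}))))"
      by (rule sum.swap_restrict) (use assms in auto)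
    moreover have "{j. j \<in> R \<and> i \<noteq> j} = R - {i}" "{j. j \<in> R \<and> j \<noteq> i} = R - {i}" for i
      by auto
    ultimately show ?thesis by simp
  qed
  also have "\<dots> = (\<Sum>j\<in>R. card R * log_root_fact (card (A j \<inter> C)) - ln (card (A j \<inter> C)))"
  proof (rule sum.cong[OF refl])
    fix j assume j: "j \<in> R"
    define r where "r = card (A j \<inter> C)"
    have sj: "s j \<in> A j \<inter> C" using bij sA j by (auto simp: bij_betw_def)
    then have r: "r > 0" using assms by (auto simp: r_def card_gt_0_iff)
    have b: "bij_betw s (R - {j}) (C - {s j})"
      using bij j by (auto simp: bij_betw_def inj_on_def)
    have "(\<Sum>i\<in>R - {j}. log_root_fact (card (A j \<inter> (C - {s i}))))
        = (\<Sum>k\<in>C - {s j}. log_root_fact (card (A j \<inter> (C - {k}))))"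
      by (rule sum.reindex_bij_betw[OF b])
    also have "C - {s j} = (A j \<inter> C - {s j}) \<union> (C - A j)" using sj by auto
    also have "(\<Sum>k\<in>\<dots>. log_root_fact (card (A j \<inter> (C - {k}))))
        = (\<Sum>k\<in>A j \<inter> C - {s j}. log_root_fact (card (A j \<inter> (C - {k}))))
          + (\<Sum>k\<in>C - A j. log_root_fact (card (A j \<inter> (C - {k}))))"
      by (rule sum.union_disjoint) (use assms in auto)
    also have "(\<Sum>k\<in>A j \<inter> C - {s j}. log_root_fact (card (A j \<inter> (C - {k}))))
        = (\<Sum>k\<in>A j \<inter> C - {s j}. log_root_fact (r - 1))"
    proof (rule sum.cong[OF refl])
      fix k assume "k \<in> A j \<inter> C - {s j}"
      then have "A j \<inter> (C - {k}) = A j \<inter> C - {k}" "k \<in> A j \<inter> C" by auto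
      then show "log_root_fact (card (A j \<inter> (C - {k}))) = log_root_fact (r - 1)"
        by (simp add: r_def)
    qed
    also have "\<dots> = ln (fact (r - 1))"
      using sj by (simp add: r_def mult_log_root_fact)
    also have "(\<Sum>k\<in>C - A j. log_root_fact (card (A j \<inter> (C - {k}))))
        = (\<Sum>k\<in>C - A j. log_root_fact r)"
      by (rule sum.cong[OF refl], unfold r_def, rule arg_cong[of _ _ "\<lambda>X. log_root_fact (card X)"]) auto
    also have "\<dots> = (real (card R) - r) * log_root_fact r"
    proof -
      have "C - A j = C - A j \<inter> C" by auto
      then have "card (C - A j) = card C - r" "r \<le> card C"
        using assms by (auto simp: r_def card_Diff_subset intro: card_mono)
      then show ?thesis using bij_betw_same_card[OF bij] by (simp add: of_nat_diff)
    qed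
    \<comment> \<open>Splitting \<open>r\<close> off the factorial lets
      \<open>r * log_root_fact r\<close> cancel against the contribution of the columns outside row
      \<open>j\<close>.\<close>
    also have "ln (fact (r - 1)) = real r * log_root_fact r - ln r"
      using r fact_nonzero[where 'a = real] by (subst mult_log_root_fact) (simp add: fact_reduce[of r] ln_mult)
    finally show "(\<Sum>i\<in>R - {j}. log_root_fact (card (A j \<inter> (C - {s i}))))
      = card R * log_root_fact (card (A j \<inter> C)) - ln (card (A j \<inter> C))"
      by (simp add: r_def[symmetric] algebra_simps)
  qed
  finally show ?thesis .
qed

text \<open>Summing \<open>sum_log_root_fact_minors\<close> over all matchings produces the
  left-hand Bregman sum, up to the logarithms of the row sums; the logarithms of the minor counts
  regroup by \<open>sum_matchings_at\<close>. Both extra contributions cancel against the row terms.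
  Being an exact identity, it yields the equality case as well as the bound.\<close>

lemma bregman_identity:
  fixes A :: "'a \<Rightarrow> 'b set"
  assumes fin: "finite R" "finite C"
  defines "S \<equiv> matchings A R C"
  shows "card R * (card S * ((\<Sum>j\<in>R. log_root_fact (card (A j \<inter> C))) - ln (card S)))
    = (\<Sum>i\<in>R. card S * ln (card (A i \<inter> C))
          + (\<Sum>k\<in>A i \<inter> C. card {s \<in> S. s i = k} * ln (card {s \<in> S. s i = k}))
          - card S * ln (card S))
      + (\<Sum>s\<in>S. \<Sum>i\<in>R. (\<Sum>j\<in>R - {i}. log_root_fact (card (A j \<inter> (C - {s i}))))
          - ln (card {t \<in> S. t i = s i}))"
proof -
  have "(\<Sum>s\<in>S. \<Sum>i\<in>R. (\<Sum>j\<in>R - {i}. log_root_fact (card (A j \<inter> (C - {s i})))))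
      = (\<Sum>s\<in>S. \<Sum>j\<in>R. card R * log_root_fact (card (A j \<inter> C)) - ln (card (A j \<inter> C)))"
    by (intro sum.cong[OF refl] sum_log_root_fact_minors) (use fin in \<open>auto simp: S_def\<close>)
  moreover have "(\<Sum>s\<in>S. \<Sum>i\<in>R. ln (card {t \<in> S. t i = s i}))
      = (\<Sum>i\<in>R. \<Sum>k\<in>A i \<inter> C. card {s \<in> S. s i = k} * ln (card {s \<in> S. s i = k}))"
    unfolding S_def
    by (subst sum.swap, rule sum.cong[OF refl], rule sum_matchings_at) (use fin in auto)
  ultimately show ?thesis
    by (simp add: sum_subtractf sum.distrib sum_distrib_left algebra_simps)
qed

section \<open>Convexity of x ln x, with equality cases\<close>

lemma mult_ln_ge_tangent:
  fixes p m :: real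
  assumes "p \<ge> 0" "m > 0"
  shows "p * ln m + p - m \<le> p * ln p"
    and "p * ln m + p - m = p * ln p \<Longrightarrow> p = m"
proof -
  \<comment> \<open>With \<open>y = m / p\<close> the gap to the tangent at \<open>m\<close> becomes
    a multiple of \<open>y - 1 - ln y\<close>; \<open>p = 0\<close> has to be treated apart.\<close>
  have *: "p * ln p - (p * ln m + p - m) = p * (m / p - 1 - ln (m / p))" if "p > 0"
    using that assms by (simp add: ln_div field_simps)
  show "p * ln m + p - m \<le> p * ln p"
  proof (cases "p = 0")
    case False
    then have "ln (m / p) \<le> m / p - 1" using assms by (intro ln_le_minus_one) auto
    then show ?thesis using * False assms
      by (smt (verit) mult_nonneg_nonneg)
  qed (use assms in auto)
  assume eq: "p * ln m + p - m = p * ln p"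
  show "p = m"
  proof (cases "p = 0")
    case False
    then have "ln (m / p) = m / p - 1" using * eq assms by auto
    then have "m / p = 1" using ln_eq_minus_one[of "m / p"] False assms by auto
    then show ?thesis using False by simp
  qed (use eq assms in auto)
qed

lemma sum_mult_ln_ge:
  fixes p :: "'a \<Rightarrow> real"
  assumes "finite K" "\<And>k. k \<in> K \<Longrightarrow> p k \<ge> 0" and pos: "(\<Sum>k\<in>K. p k) > 0"
  defines "P \<equiv> \<Sum>k\<in>K. p k"
  shows "0 \<le> P * ln (card K) + (\<Sum>k\<in>K. p k * ln (p k)) - P * ln P"
    and "P * ln (card K) + (\<Sum>k\<in>K. p k * ln (p k)) - P * ln P = 0 \<longleftrightarrow> (\<forall>k\<in>K. p k = P / card K)"
proof -
  have K: "card K > 0" using assms by (auto simp: card_gt_0_iff)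
  define m where "m = P / card K"
  have m: "m > 0" using K pos by (simp add: m_def P_def)
  have "(\<Sum>k\<in>K. p k * ln (p k) - (p k * ln m + p k - m)) = (\<Sum>k\<in>K. p k * ln (p k)) - (P * ln m + P - card K * m)"
    by (simp add: sum_subtractf sum.distrib P_def sum_distrib_left algebra_simps)
  also have "\<dots> = P * ln (card K) + (\<Sum>k\<in>K. p k * ln (p k)) - P * ln P"
    using K pos by (simp add: m_def P_def ln_div algebra_simps)
  finally have eq: "P * ln (card K) + (\<Sum>k\<in>K. p k * ln (p k)) - P * ln P
      = (\<Sum>k\<in>K. p k * ln (p k) - (p k * ln m + p k - m))" ..
  have nn: "0 \<le> p k * ln (p k) - (p k * ln m + p k - m)" if "k \<in> K" for k
    using mult_ln_ge_tangent(1)[of "p k" m] that assms m by auto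
  show "0 \<le> P * ln (card K) + (\<Sum>k\<in>K. p k * ln (p k)) - P * ln P"
    unfolding eq by (rule sum_nonneg) (rule nn)
  have "(\<Sum>k\<in>K. p k * ln (p k) - (p k * ln m + p k - m)) = 0
      \<longleftrightarrow> (\<forall>k\<in>K. p k * ln (p k) - (p k * ln m + p k - m) = 0)"
    by (rule sum_nonneg_eq_0_iff) (use assms nn in auto)
  also have "\<dots> \<longleftrightarrow> (\<forall>k\<in>K. p k = m)"
    using mult_ln_ge_tangent(2)[of _ m] assms m by (auto simp: algebra_simps)
  finally show "P * ln (card K) + (\<Sum>k\<in>K. p k * ln (p k)) - P * ln P = 0 \<longleftrightarrow> (\<forall>k\<in>K. p k = P / card K)"
    by (simp add: eq m_def)
qed

lemma matchings_empty_rows: "matchings A {} C = (if C = {} then {\<lambda>_. undefined} else {})"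
  by (auto simp: matchings_def bij_betw_def)

lemma sum_card_matchings_at:
  assumes "finite R" "finite C" "i \<in> R"
  shows "(\<Sum>k\<in>A i \<inter> C. real (card {s \<in> matchings A R C. s i = k})) = card (matchings A R C)"
  using sum_matchings_at[OF assms, where g = "\<lambda>_. 1"] by simp

text \<open>In \<open>bregman_identity\<close> the row terms are nonnegative by convexity and the
  minor terms by the induction hypothesis; the factors \<open>card R\<close> and the number of
  matchings are positive.\<close>

theorem bregman:
  assumes "finite R" "finite C" "matchings A R C \<noteq> {}"
  shows "ln (card (matchings A R C)) \<le> (\<Sum>j\<in>R. log_root_fact (card (A j \<inter> C)))"
  using assms
proof (induction R arbitrary: C rule: finite_psubset_induct)
  case (psubset R)
  let ?S = "matchings A R C"
  show ?case
  proof (cases "R = {}")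
    case True
    then show ?thesis by (auto simp: matchings_empty_rows)
  next
    case False
    have fin: "finite ?S" using psubset by (simp add: finite_matchings)
    then have P: "card ?S > 0" using psubset by (auto simp: card_gt_0_iff)
    have R: "card R > 0" using psubset False by (simp add: card_gt_0_iff)
    have "0 \<le> card R * (card ?S * ((\<Sum>j\<in>R. log_root_fact (card (A j \<inter> C))) - ln (card ?S)))"
      unfolding bregman_identity[OF psubset(1) psubset(3)]
    proof (intro add_nonneg_nonneg sum_nonneg)
      fix i assume "i \<in> R"
      then show "0 \<le> card ?S * ln (card (A i \<inter> C))
          + (\<Sum>k\<in>A i \<inter> C. card {s \<in> ?S. s i = k} * ln (card {s \<in> ?S. s i = k}))
          - card ?S * ln (card ?S)"
        using sum_mult_ln_ge(1)[of "A i \<inter> C" "\<lambda>k. card {s \<in> ?S. s i = k}"] psubset P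
        by (simp add: sum_card_matchings_at)
    next
      fix s i assume si: "s \<in> ?S" "i \<in> R"
      then have k: "s i \<in> C" "s i \<in> A i" by (auto simp: matchings_def bij_betw_def)
      \<comment> \<open>The matching \<open>s\<close> itself uses the entry at \<open>i\<close> and
        \<open>s i\<close>, so the minor there has a matching and the induction hypothesis
        applies.\<close>
      have "{t \<in> ?S. t i = s i} \<noteq> {}" using si by auto
      then have "card {t \<in> ?S. t i = s i} > 0" using fin by (subst card_gt_0_iff) auto
      then have "matchings A (R - {i}) (C - {s i}) \<noteq> {}"
        unfolding card_matchings_fixed[of i R "s i" C A, OF si(2) k] by (auto simp: card_gt_0_iff)
      then have "ln (card (matchings A (R - {i}) (C - {s i})))
          \<le> (\<Sum>j\<in>R - {i}. log_root_fact (card (A j \<inter> (C - {s i}))))"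
        using si psubset by (intro psubset.IH) auto
      then show "0 \<le> (\<Sum>j\<in>R - {i}. log_root_fact (card (A j \<inter> (C - {s i}))))
          - ln (card {t \<in> ?S. t i = s i})"
        by (simp add: card_matchings_fixed si k)
    qed
    then show ?thesis using P R by (simp add: zero_le_mult_iff)
  qed
qed

section \<open>The equality case: patterns made of disjoint all-ones blocks\<close>

definition rectangular :: "('a \<Rightarrow> 'b set) \<Rightarrow> 'a set \<Rightarrow> 'b set \<Rightarrow> bool" where
  "rectangular A R C \<longleftrightarrow> (\<forall>x\<in>R. \<forall>y\<in>R. A x \<inter> A y \<inter> C \<noteq> {} \<longrightarrow> A x \<inter> C = A y \<inter> C)"

lemma rectangularD:
  assumes "rectangular A R C" "x \<in> R" "y \<in> R" "u \<in> A x" "u \<in> A y" "u \<in> C" "v \<in> A x" "v \<in> C"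
  shows "v \<in> A y"
  using assms unfolding rectangular_def by blast

lemma rectangular_minor: "rectangular A R C \<Longrightarrow> rectangular A (R - {i}) (C - {k})"
  unfolding rectangular_def by blast

text \<open>A failure is a 2 by 2 pattern with three ones and one zero. A one away from both its
  rows and both its columns would leave the pattern intact in a minor, so there is none. This leaves
  at most three rows, where two matchings force a failure in another minor.\<close>

lemma rectangularI_minors:
  assumes ex: "\<And>i k. i \<in> R \<Longrightarrow> k \<in> A i \<Longrightarrow> k \<in> C \<Longrightarrow> \<exists>s\<in>matchings A R C. s i = k"
    and rect: "\<And>i k. i \<in> R \<Longrightarrow> k \<in> A i \<Longrightarrow> k \<in> C \<Longrightarrow> rectangular A (R - {i}) (C - {k})"
  shows "rectangular A R C"
proof (rule ccontr)
  assume "\<not> rectangular A R C"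
  then obtain i1 i2 j1 j2 where i: "i1 \<in> R" "i2 \<in> R" and j: "j1 \<in> C" "j2 \<in> C"
    and ones: "j1 \<in> A i1" "j1 \<in> A i2" "j2 \<in> A i1" and zero: "j2 \<notin> A i2"
    unfolding rectangular_def by blast
  have minor: "v \<in> A y" if "i \<in> R" "k \<in> A i" "k \<in> C" "x \<in> R - {i}" "y \<in> R - {i}"
    "u \<in> A x" "u \<in> A y" "u \<in> C - {k}" "v \<in> A x" "v \<in> C - {k}" for i k x y u v
    using rectangularD[OF rect[OF that(1-3)] that(4-10)] .
  \<comment> \<open>Otherwise the minor at \<open>i\<close> and \<open>k\<close> still contains the
    forbidden pattern.\<close>
  have small: "i \<in> {i1, i2} \<or> k \<in> {j1, j2}" if "i \<in> R" "k \<in> A i" "k \<in> C" for i k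
    using minor[OF that, of i1 i2 j1 j2] i j ones zero by auto
  obtain s where s: "s \<in> matchings A R C" "s i1 = j1" using ex i j ones by blast
  then have inj: "inj_on s R" and im: "s ` R = C" and sA: "\<And>i. i \<in> R \<Longrightarrow> s i \<in> A i"
    by (auto simp: matchings_def bij_betw_def)
  \<comment> \<open>Since \<open>s\<close> gives \<open>j1\<close> to \<open>i1\<close> and row
    \<open>i2\<close> has a zero at \<open>j2\<close>, row \<open>i2\<close> is matched to a third
    column and \<open>j2\<close> belongs to a third row.\<close>
  define j3 where "j3 = s i2"
  obtain i3 where i3: "i3 \<in> R" "s i3 = j2" using im j by auto
  have j3: "j3 \<in> A i2" "j3 \<in> C" "j3 \<noteq> j1" "j3 \<noteq> j2"
    using sA[of i2] im i inj s ones zero by (auto simp: j3_def inj_on_def)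
  have i3': "i3 \<noteq> i1" "i3 \<noteq> i2" "j2 \<in> A i3" using i3 s ones zero j3 sA[of i3] by (auto simp: j3_def)
  \<comment> \<open>A fourth row would be matched to a column other than \<open>j1\<close> and
    \<open>j2\<close>, against \<open>small\<close>.\<close>
  have R: "R = {i1, i2, i3}"
  proof -
    have "i \<in> {i1, i2, i3}" if "i \<in> R" for i
    proof (rule ccontr)
      assume "i \<notin> {i1, i2, i3}"
      then have "s i \<noteq> j1" "s i \<noteq> j2" using that i i3 s inj by (auto simp: inj_on_def)
      then show False using small[of i "s i"] that sA im \<open>i \<notin> {i1, i2, i3}\<close> by auto
    qed
    then show ?thesis using i i3 by auto
  qed
  then have C: "C = {j1, j3, j2}" using im s i3 by (auto simp: j3_def)
  have z: "j3 \<notin> A i3" using small[of i3 j3] i3 j3 i3' by auto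
  \<comment> \<open>With \<open>j1\<close> given to \<open>i2\<close> and a zero at
    \<open>i3\<close>, \<open>j3\<close>, the matching \<open>t\<close> must send \<open>i3\<close>
    to \<open>j2\<close> and \<open>i1\<close> to \<open>j3\<close>. Then rows \<open>i1\<close> and
    \<open>i3\<close> share \<open>j2\<close> but differ at \<open>j3\<close>, and both survive in
    the minor at \<open>i2\<close>, \<open>j1\<close>.\<close>
  obtain t where t: "t \<in> matchings A R C" "t i2 = j1" using ex i j ones by blast
  then have injt: "inj_on t R" and imt: "t ` R = C" and tA: "\<And>i. i \<in> R \<Longrightarrow> t i \<in> A i"
    by (auto simp: matchings_def bij_betw_def)
  have "t i3 \<in> C" "t i3 \<noteq> j1" "t i3 \<noteq> j3"
    using imt i3 i3' tA[of i3] z injt t i by (auto simp: inj_on_def)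
  then have "t i3 = j2" using C by auto
  moreover have "t i1 \<in> C" "t i1 \<noteq> t i2" "t i1 \<noteq> t i3"
    using imt i i3 i3' injt ones zero by (auto simp: inj_on_def)
  ultimately have "t i1 = j3" using C t by auto
  then have "j3 \<in> A i1" using tA[of i1] i by auto
  moreover have "i1 \<noteq> i2" using ones zero by auto
  ultimately have "j3 \<in> A i3"
    using minor[of i2 j1 i1 i3 j2 j3] i i3 i3' j j3 ones zero by auto
  then show False using z by simp
qed

text \<open>Columns belonging to a common row of a rectangular pattern are identical, so exchanging
  them permutes the matchings.\<close>
lemma rectangular_card_fixed_le:
  assumes fin: "finite R" "finite C" and rect: "rectangular A R C"
    and i: "i \<in> R" and k: "k \<in> A i" "k \<in> C" and l: "l \<in> A i" "l \<in> C"
  shows "card {s \<in> matchings A R C. s i = k} \<le> card {s \<in> matchings A R C. s i = l}"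
proof (rule card_inj_on_le)
  let ?\<tau> = "transpose k l"
  let ?f = "\<lambda>s. restrict (?\<tau> \<circ> s) R"
  have bt: "bij_betw ?\<tau> C C"
    using k l permutes_swap_id[of k C l] by (auto intro: permutes_imp_bij)
  show "inj_on ?f {s \<in> matchings A R C. s i = k}"
  proof (rule inj_onI)
    fix s t assume st: "s \<in> {s \<in> matchings A R C. s i = k}" "t \<in> {s \<in> matchings A R C. s i = k}"
      and eq: "?f s = ?f t"
    have "s x = t x" for x
    proof (cases "x \<in> R")
      case True
      then have "?\<tau> (s x) = ?\<tau> (t x)" using fun_cong[OF eq, of x] by simp
      then show ?thesis by (metis transpose_involutory)
    next
      case False
      then show ?thesis using st by (auto simp: matchings_def extensional_def)
    qed
    then show "s = t" by auto
  qed
  show "?f ` {s \<in> matchings A R C. s i = k} \<subseteq> {s \<in> matchings A R C. s i = l}"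
  proof (intro image_subsetI)
    fix s assume s: "s \<in> {s \<in> matchings A R C. s i = k}"
    then have b: "bij_betw s R C" and sA: "\<And>x. x \<in> R \<Longrightarrow> s x \<in> A x" by (auto simp: matchings_def)
    have "bij_betw (?\<tau> \<circ> s) R C" by (rule bij_betw_trans[OF b bt])
    moreover have "bij_betw (?f s) R C = bij_betw (?\<tau> \<circ> s) R C" by (rule bij_betw_cong) simp
    moreover have "?\<tau> (s x) \<in> A x" if "x \<in> R" for x
      using sA[OF that] that rectangularD[OF rect i that, of k l] rectangularD[OF rect i that, of l k] k l
      by (auto simp: transpose_def)
    ultimately show "?f s \<in> {s \<in> matchings A R C. s i = l}" using s i by (auto simp: matchings_def)
  qed
  show "finite {s \<in> matchings A R C. s i = l}" using fin by (simp add: finite_matchings)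
qed

text \<open>Equality holds iff every term of \<open>bregman_identity\<close> vanishes: the matchings
  through a row are equally distributed over its ones, and, by induction, all minors along matchings
  are rectangular. The first condition makes the second reach every one of the pattern.\<close>

theorem bregman_eq_iff:
  assumes "finite R" "finite C" "matchings A R C \<noteq> {}"
  shows "ln (card (matchings A R C)) = (\<Sum>j\<in>R. log_root_fact (card (A j \<inter> C)))
    \<longleftrightarrow> rectangular A R C"
  using assms
proof (induction R arbitrary: C rule: finite_psubset_induct)
  case (psubset R)
  let ?S = "matchings A R C"
  let ?N = "\<lambda>i k. card {s \<in> ?S. s i = k}"
  let ?row = "\<lambda>i. card ?S * ln (card (A i \<inter> C)) + (\<Sum>k\<in>A i \<inter> C. ?N i k * ln (?N i k))
    - card ?S * ln (card ?S)"
  let ?minor = "\<lambda>s i. (\<Sum>j\<in>R - {i}. log_root_fact (card (A j \<inter> (C - {s i})))) - ln (?N i (s i))"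
  show ?case
  proof (cases "R = {}")
    case True
    then show ?thesis using psubset by (auto simp: matchings_empty_rows rectangular_def split: if_splits)
  next
    case False
    have fin: "finite ?S" using psubset by (simp add: finite_matchings)
    then have P: "card ?S > 0" using psubset by (auto simp: card_gt_0_iff)
    have R: "card R > 0" using psubset False by (simp add: card_gt_0_iff)
    have row: "0 \<le> ?row i" "?row i = 0 \<longleftrightarrow> (\<forall>k\<in>A i \<inter> C. ?N i k = card ?S / card (A i \<inter> C))"
      if "i \<in> R" for i
      using sum_mult_ln_ge[of "A i \<inter> C" "?N i"] psubset P that by (simp_all add: sum_card_matchings_at)
    have minor: "0 \<le> ?minor s i" "?minor s i = 0 \<longleftrightarrow> rectangular A (R - {i}) (C - {s i})"
      if si: "s \<in> ?S" "i \<in> R" for s i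
    proof -
      have k: "s i \<in> C" "s i \<in> A i" using si by (auto simp: matchings_def bij_betw_def)
      have "{t \<in> ?S. t i = s i} \<noteq> {}" using si by auto
      then have "?N i (s i) > 0" using fin by (subst card_gt_0_iff) auto
      then have ne: "matchings A (R - {i}) (C - {s i}) \<noteq> {}"
        unfolding card_matchings_fixed[of i R "s i" C A, OF si(2) k] by (auto simp: card_gt_0_iff)
      show "0 \<le> ?minor s i"
        using bregman[OF _ _ ne] psubset si by (simp add: card_matchings_fixed si k)
      show "?minor s i = 0 \<longleftrightarrow> rectangular A (R - {i}) (C - {s i})"
      proof -
        have "R - {i} \<subset> R" using si by auto
        from psubset.IH[OF this _ ne] show ?thesis
          using psubset(3) by (auto simp: card_matchings_fixed si k)
      qed
    qed
    have "ln (card ?S) = (\<Sum>j\<in>R. log_root_fact (card (A j \<inter> C)))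
        \<longleftrightarrow> card R * (card ?S * ((\<Sum>j\<in>R. log_root_fact (card (A j \<inter> C))) - ln (card ?S))) = 0"
      using P R by auto
    also have "\<dots> \<longleftrightarrow> (\<Sum>i\<in>R. ?row i) = 0 \<and> (\<Sum>s\<in>?S. \<Sum>i\<in>R. ?minor s i) = 0"
      unfolding bregman_identity[OF psubset(1) psubset(3)]
      by (rule add_nonneg_eq_0_iff) (intro sum_nonneg row minor; assumption)+
    also have "(\<Sum>i\<in>R. ?row i) = 0 \<longleftrightarrow> (\<forall>i\<in>R. ?row i = 0)"
      by (rule sum_nonneg_eq_0_iff) (use psubset row in auto)
    also have "(\<Sum>s\<in>?S. \<Sum>i\<in>R. ?minor s i) = 0 \<longleftrightarrow> (\<forall>s\<in>?S. (\<Sum>i\<in>R. ?minor s i) = 0)"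
      by (rule sum_nonneg_eq_0_iff[OF fin]) (intro sum_nonneg minor; assumption)
    also have "\<dots> \<longleftrightarrow> (\<forall>s\<in>?S. \<forall>i\<in>R. ?minor s i = 0)"
      by (intro ball_cong refl sum_nonneg_eq_0_iff psubset(1) minor; assumption)
    also have "(\<forall>i\<in>R. ?row i = 0) \<and> (\<forall>s\<in>?S. \<forall>i\<in>R. ?minor s i = 0)
        \<longleftrightarrow> (\<forall>i\<in>R. \<forall>k\<in>A i \<inter> C. ?N i k = card ?S / card (A i \<inter> C))
          \<and> (\<forall>s\<in>?S. \<forall>i\<in>R. rectangular A (R - {i}) (C - {s i}))"
      using row(2) minor(2) by simp
    also have "\<dots> \<longleftrightarrow> rectangular A R C"
    proof (intro iffI conjI ballI)
      assume *: "(\<forall>i\<in>R. \<forall>k\<in>A i \<inter> C. ?N i k = card ?S / card (A i \<inter> C))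
          \<and> (\<forall>s\<in>?S. \<forall>i\<in>R. rectangular A (R - {i}) (C - {s i}))"
      \<comment> \<open>A vanishing row term makes \<open>?N i k\<close> equal to a positive mean,
        so every one lies on a matching.\<close>
      have ex: "\<exists>s\<in>?S. s i = k" if "i \<in> R" "k \<in> A i" "k \<in> C" for i k
      proof -
        have "card (A i \<inter> C) > 0" using that psubset by (auto simp: card_gt_0_iff)
        then have "card ?S / card (A i \<inter> C) > 0" using P by simp
        moreover have "real (?N i k) = card ?S / card (A i \<inter> C)" using * that by blast
        ultimately have "?N i k > 0" by linarith
        then have "{s \<in> ?S. s i = k} \<noteq> {}" by (metis card.empty less_irrefl)
        then show ?thesis by auto
      qed
      show "rectangular A R C"
        by (rule rectangularI_minors[OF ex]) (use ex * in blast)+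
    next
      fix i k assume rect: "rectangular A R C" and i: "i \<in> R" and k: "k \<in> A i \<inter> C"
      \<comment> \<open>Exchanging columns gives the inequality in both directions, so all ones of
        the row share the matchings equally.\<close>
      have "real (?N i l) = ?N i k" if "l \<in> A i \<inter> C" for l
        using rectangular_card_fixed_le[OF psubset(1) psubset(3) rect i] k that
        by (simp add: order_antisym)
      then have "(\<Sum>l\<in>A i \<inter> C. real (?N i l)) = card (A i \<inter> C) * real (?N i k)" by simp
      moreover have "card (A i \<inter> C) > 0" using k psubset by (auto simp: card_gt_0_iff)
      ultimately show "?N i k = card ?S / card (A i \<inter> C)"
        using sum_card_matchings_at[of R C i A] psubset i k by (auto simp: field_simps)
    qed (rule rectangular_minor)
    finally show ?thesis .
  qed
qed

section \<open>Strict concavity of $\ln(r!)/r$\<close>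

text \<open>This is the strict concavity of \<open>log_root_fact\<close> cleared of
  denominators.\<close>

lemma ln_ratio_lt:
  assumes "r \<ge> 1"
  shows "real r * (r + 1) * (ln (r + 2) - ln (r + 1)) < 2 * (r * ln (r + 1) - ln (fact r))"
  using assms
proof (induction r rule: nat_induct_at_least)
  case base
  have "ln (3::real) < ln (2 ^ 2)" by simp
  also have "\<dots> = 2 * ln 2" by (subst ln_realpow) auto
  finally show ?case by simp
next
  case (Suc r)
  define a b c F where "a = ln (real r + 1)" and "b = ln (real r + 2)" and "c = ln (real r + 3)"
    and "F = ln (fact r :: real)"
  have "ln ((real r + 3) * (r + 1)) < ln ((real r + 2) * (r + 2))"
    by (subst ln_less_cancel_iff) (auto simp: algebra_simps add_pos_nonneg)
  also have "ln ((real r + 2) * (r + 2)) = b + b"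
    unfolding b_def by (subst ln_mult) auto
  also have "ln ((real r + 3) * (r + 1)) = c + a"
    unfolding a_def c_def by (subst ln_mult) auto
  finally have "c - b < b - a" by simp
  then have "(real r + 1) * (r + 2) * (c - b) < (real r + 1) * (r + 2) * (b - a)"
    by (intro mult_strict_left_mono) auto
  \<comment> \<open>Relative to the induction hypothesis both sides have grown by the same amount
    \<open>2 * (r + 1) * (b - a)\<close>. Concavity of \<open>ln\<close> has already replaced
    \<open>c - b\<close> by \<open>b - a\<close>.\<close>
  also have "\<dots> < 2 * ((real r + 1) * b - (F + a))"
    using Suc.IH by (simp add: a_def b_def F_def algebra_simps)
  also have "F + a = ln (fact (Suc r))"
    by (simp add: F_def a_def ln_mult add.commute)
  finally show ?case by (simp add: a_def b_def c_def algebra_simps)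
qed

text \<open>The difference of the two sides is the gap of \<open>ln_ratio_lt\<close> over
  \<open>r * (r + 1) * (r + 2)\<close>. The case \<open>r = 0\<close> must be excluded:
  \<open>log_root_fact\<close> is 0 at 0 and at 1 but positive at 2.\<close>

lemma log_root_fact_diff_less:
  assumes "r \<ge> 1"
  shows "log_root_fact (Suc (Suc r)) - log_root_fact (Suc r) < log_root_fact (Suc r) - log_root_fact r"
proof -
  define a b F where "a = ln (real r + 1)" and "b = ln (real r + 2)" and "F = ln (fact r :: real)"
  have r: "real r > 0" using assms by simp
  have l: "log_root_fact r = F / r" "log_root_fact (Suc r) = (F + a) / (real r + 1)"
    "log_root_fact (Suc (Suc r)) = (F + a + b) / (real r + 2)"
    by (simp_all add: log_root_fact_def F_def a_def b_def ln_mult add.commute)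
  have "(F + a) / (x + 1) - F / x - ((F + a + b) / (x + 2) - (F + a) / (x + 1))
     = (2 * (x * a - F) - x * (x + 1) * (b - a)) / (x * (x + 1) * (x + 2))"
    if "x > 0" for x
  proof -
    have "x \<noteq> 0" "x + 1 \<noteq> 0" "x + 2 \<noteq> 0" using that by auto
    then show ?thesis by (simp add: divide_simps) (simp add: algebra_simps)
  qed
  then have "(F + a) / (real r + 1) - F / real r - ((F + a + b) / (real r + 2) - (F + a) / (real r + 1))
     = (2 * (real r * a - F) - real r * (real r + 1) * (b - a)) / (real r * (real r + 1) * (real r + 2))"
    using r by blast
  also have "\<dots> > 0"
    using ln_ratio_lt[OF assms] r by (intro divide_pos_pos) (auto simp: a_def b_def F_def)
  finally show ?thesis unfolding l by simp
qed

lemma strict_antimono_log_root_fact_diff: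
  assumes "1 \<le> r" "r < k"
  shows "log_root_fact (Suc k) - log_root_fact k < log_root_fact (Suc r) - log_root_fact r"
  using assms(2,1)
proof (induction r rule: strict_inc_induct)
  case (base i)
  then show ?case using log_root_fact_diff_less by simp
next
  case (step i)
  then show ?case using log_root_fact_diff_less[of i] by simp
qed

text \<open>The right-hand side is the chord through \<open>k\<close> and \<open>k + 1\<close>,
  extended to \<open>r\<close>; each further step of \<open>log_root_fact\<close> gains less than
  the slope of the chord.\<close>

lemma log_root_fact_above:
  assumes "1 \<le> k" "k + 2 \<le> r"
  shows "log_root_fact r < log_root_fact k + (real r - k) * (log_root_fact (k + 1) - log_root_fact k)"
  using assms(2)
proof (induction r rule: nat_induct_at_least)
  case base
  then show ?case using log_root_fact_diff_less[OF assms(1)] by (simp add: algebra_simps)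
next
  case (Suc r)
  then show ?case
    using strict_antimono_log_root_fact_diff[of k r] assms(1) by (simp add: algebra_simps)
qed

lemma log_root_fact_below:
  assumes "1 \<le> r" "r < k"
  shows "log_root_fact r < log_root_fact k + (real r - k) * (log_root_fact (k + 1) - log_root_fact k)"
proof -
  \<comment> \<open>The slope and \<open>r\<close> stay fixed while the base point \<open>m\<close>
    climbs from \<open>r + 1\<close> to \<open>k\<close>; below \<open>k\<close> every increment
    exceeds the slope.\<close>
  have "log_root_fact r < log_root_fact m + (real r - m) * (log_root_fact (k + 1) - log_root_fact k)"
    if "Suc r \<le> m" "m \<le> k" for m
    using that
  proof (induction m rule: nat_induct_at_least)
    case base
    then show ?case
      using strict_antimono_log_root_fact_diff[of r k] assms by (simp add: algebra_simps)
  next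
    case (Suc m)
    then show ?case
      using strict_antimono_log_root_fact_diff[of m k] assms by (simp add: algebra_simps)
  qed
  then show ?thesis using assms by simp
qed

lemma log_root_fact_le:
  assumes "1 \<le> k" "1 \<le> r"
  shows "log_root_fact r \<le> log_root_fact k + (real r - k) * (log_root_fact (k + 1) - log_root_fact k)"
    and "log_root_fact r = log_root_fact k + (real r - k) * (log_root_fact (k + 1) - log_root_fact k)
      \<longleftrightarrow> r \<in> {k, k + 1}"
proof -
  consider "r < k" | "r = k" | "r = k + 1" | "k + 2 \<le> r" by linarith
  then have "log_root_fact r \<le> log_root_fact k + (real r - k) * (log_root_fact (k + 1) - log_root_fact k)
    \<and> (log_root_fact r = log_root_fact k + (real r - k) * (log_root_fact (k + 1) - log_root_fact k)
      \<longleftrightarrow> r \<in> {k, k + 1})"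
    by cases (use log_root_fact_below[of r k] log_root_fact_above[of k r] assms in force)+
  then show "log_root_fact r \<le> log_root_fact k + (real r - k) * (log_root_fact (k + 1) - log_root_fact k)"
    and "log_root_fact r = log_root_fact k + (real r - k) * (log_root_fact (k + 1) - log_root_fact k)
      \<longleftrightarrow> r \<in> {k, k + 1}" by auto
qed

text \<open>Sum the chord through \<open>k\<close> and \<open>k + 1\<close> over the rows: being
  affine, it sees only the number of rows and their total. If all row sums are \<open>k\<close> or
  \<open>k + 1\<close>, then \<open>u\<close> and \<open>v\<close> count the rows with
  \<open>k + 1\<close> and with \<open>k\<close> ones.\<close>

lemma sum_log_root_fact_le:
  fixes r :: "'a \<Rightarrow> nat"
  assumes "finite R" "1 \<le> k" "\<And>i. i \<in> R \<Longrightarrow> 1 \<le> r i"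
  defines "u \<equiv> real (\<Sum>i\<in>R. r i) - k * card R" and "v \<equiv> (k + 1) * card R - real (\<Sum>i\<in>R. r i)"
  shows "(\<Sum>i\<in>R. log_root_fact (r i)) \<le> u * log_root_fact (k + 1) + v * log_root_fact k"
    and "(\<Sum>i\<in>R. log_root_fact (r i)) = u * log_root_fact (k + 1) + v * log_root_fact k
      \<longleftrightarrow> (\<forall>i\<in>R. r i \<in> {k, k + 1})"
proof -
  let ?g = "\<lambda>i. log_root_fact k + (real (r i) - k) * (log_root_fact (k + 1) - log_root_fact k)"
  have "(\<Sum>i\<in>R. ?g i) = card R * log_root_fact k
      + (real (\<Sum>i\<in>R. r i) - k * card R) * (log_root_fact (k + 1) - log_root_fact k)"
    by (simp add: sum.distrib sum_subtractf flip: sum_distrib_right)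
  also have "\<dots> = u * log_root_fact (k + 1) + v * log_root_fact k"
    unfolding u_def v_def by (simp add: algebra_simps)
  finally have g: "(\<Sum>i\<in>R. ?g i) = u * log_root_fact (k + 1) + v * log_root_fact k" .
  show "(\<Sum>i\<in>R. log_root_fact (r i)) \<le> u * log_root_fact (k + 1) + v * log_root_fact k"
    unfolding g[symmetric] by (rule sum_mono) (use log_root_fact_le assms in auto)
  have "(\<Sum>i\<in>R. log_root_fact (r i)) = (\<Sum>i\<in>R. ?g i)
      \<longleftrightarrow> (\<Sum>i\<in>R. ?g i - log_root_fact (r i)) = 0"
    by (auto simp: sum_subtractf)
  also have "\<dots> \<longleftrightarrow> (\<forall>i\<in>R. ?g i - log_root_fact (r i) = 0)"
    by (rule sum_nonneg_eq_0_iff) (use assms log_root_fact_le(1) in auto)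
  also have "\<dots> \<longleftrightarrow> (\<forall>i\<in>R. log_root_fact (r i) = ?g i)" by auto
  also have "\<dots> \<longleftrightarrow> (\<forall>i\<in>R. r i \<in> {k, k + 1})"
    by (intro ball_cong refl log_root_fact_le(2)) (use assms in auto)
  finally show "(\<Sum>i\<in>R. log_root_fact (r i)) = u * log_root_fact (k + 1) + v * log_root_fact k
      \<longleftrightarrow> (\<forall>i\<in>R. r i \<in> {k, k + 1})" unfolding g .
qed

section \<open>Rectangular patterns up to isomorphism\<close>

lemma rectangular_mem_iff:
  assumes "rectangular A R C" "x \<in> R" "y \<in> R" "u \<in> A x" "u \<in> C"
  shows "u \<in> A y \<longleftrightarrow> A x \<inter> C = A y \<inter> C"
proof
  assume "u \<in> A y"
  then have "A x \<inter> A y \<inter> C \<noteq> {}" using assms by blast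
  then show "A x \<inter> C = A y \<inter> C" using assms(1-3) by (auto simp only: rectangular_def)
next
  assume "A x \<inter> C = A y \<inter> C"
  moreover have "u \<in> A x \<inter> C" using assms by simp
  ultimately show "u \<in> A y" by simp
qed

text \<open>Fibres are disjoint, so removing a whole fibre leaves the others intact and only the
  count at its own size changes.\<close>

lemma card_fibre_remove:
  assumes "finite X" and X0: "X0 = {y \<in> X. f y = f x0}"
  shows "card {x \<in> X - X0. card {y \<in> X - X0. f y = f x} = c}
    = card {x \<in> X. card {y \<in> X. f y = f x} = c} - (if c = card X0 then card X0 else 0)"
proof -
  define F where "F x = {y \<in> X. f y = f x}" for x
  have F0: "F x = X0" if "x \<in> X0" for x
    using that by (auto simp: X0 F_def)
  have F1: "{y \<in> X - X0. f y = f x} = F x" if "x \<in> X" "x \<notin> X0" for x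
    using that by (auto simp: X0 F_def)
  have mem: "x \<in> {x \<in> X - X0. card {y \<in> X - X0. f y = f x} = c}
      \<longleftrightarrow> x \<in> {x \<in> X. card (F x) = c} - (if c = card X0 then X0 else {})" for x
  proof (cases "x \<in> X \<and> x \<notin> X0")
    case True
    then have "{y \<in> X - X0. f y = f x} = F x" by (intro F1) auto
    then show ?thesis using True by (simp only: mem_Collect_eq Diff_iff) simp
  next
    case False
    then show ?thesis by (cases "x \<in> X0") (simp_all add: F0)
  qed
  have "{x \<in> X - X0. card {y \<in> X - X0. f y = f x} = c}
      = {x \<in> X. card (F x) = c} - (if c = card X0 then X0 else {})"
    using mem by blast
  moreover have "X0 \<subseteq> X" "finite X0" using assms(1) by (auto simp: X0)
  moreover from this have "(if c = card X0 then X0 else {}) \<subseteq> {x \<in> X. card (F x) = c}"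
    by (auto simp: F0 subset_iff)
  ultimately show ?thesis
    by (simp add: card_Diff_subset flip: F_def)
qed

text \<open>The hypothesis counts points by the size of their fibre, which fixes how many fibres of
  each size there are. Pair one fibre of \<open>f\<close> with a fibre of \<open>g\<close> of equal
  size, remove both and induct.\<close>

lemma bij_betw_fibre_card:
  fixes f :: "'a \<Rightarrow> 'c" and g :: "'b \<Rightarrow> 'd"
  assumes "finite X" "finite Y"
    and "\<And>c. card {x \<in> X. card {y \<in> X. f y = f x} = c} = card {x \<in> Y. card {y \<in> Y. g y = g x} = c}"
  shows "\<exists>h. bij_betw h X Y \<and> (\<forall>x\<in>X. \<forall>y\<in>X. f x = f y \<longleftrightarrow> g (h x) = g (h y))"
  using assms
proof (induction X arbitrary: Y rule: finite_psubset_induct)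
  case (psubset X)
  show ?case
  proof (cases "X = {}")
    case True
    have "Y = {}"
    proof (rule ccontr)
      assume "Y \<noteq> {}"
      then obtain y where "y \<in> Y" by auto
      then have "y \<in> {x \<in> Y. card {z \<in> Y. g z = g x} = card {z \<in> Y. g z = g y}}" by simp
      then have "card {x \<in> Y. card {z \<in> Y. g z = g x} = card {z \<in> Y. g z = g y}} > 0"
        using psubset(3) by (subst card_gt_0_iff) auto
      then show False unfolding psubset(4)[symmetric] by (simp add: True)
    qed
    then show ?thesis using True by (auto simp: bij_betw_def)
  next
    case False
    then obtain x0 where x0: "x0 \<in> X" by auto
    define X0 where "X0 = {y \<in> X. f y = f x0}"
    have fin: "finite X0" "finite X" "finite Y" using psubset by (auto simp: X0_def)
    have "x0 \<in> {x \<in> X. card {y \<in> X. f y = f x} = card X0}" using x0 by (auto simp: X0_def)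
    then have "card {x \<in> X. card {y \<in> X. f y = f x} = card X0} > 0"
      using fin by (subst card_gt_0_iff) auto
    then have "card {x \<in> Y. card {y \<in> Y. g y = g x} = card X0} > 0"
      by (simp only: psubset(4))
    then have "{x \<in> Y. card {y \<in> Y. g y = g x} = card X0} \<noteq> {}"
      unfolding card_gt_0_iff by (rule conjunct1)
    then obtain y0 where y0: "y0 \<in> Y" "card {y \<in> Y. g y = g y0} = card X0" by auto
    define Y0 where "Y0 = {y \<in> Y. g y = g y0}"
    have cY0: "card Y0 = card X0" "finite Y0" using y0 fin by (auto simp: Y0_def)
    note dist_X = card_fibre_remove[OF fin(2) X0_def]
    note dist_Y = card_fibre_remove[OF fin(3) Y0_def, unfolded cY0(1)]
    have "X - X0 \<subset> X" using x0 by (auto simp: X0_def)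
    moreover have "card {x \<in> X - X0. card {y \<in> X - X0. f y = f x} = c}
        = card {x \<in> Y - Y0. card {y \<in> Y - Y0. g y = g x} = c}" for c
      unfolding dist_X dist_Y psubset(4) ..
    ultimately have "\<exists>h. bij_betw h (X - X0) (Y - Y0)
        \<and> (\<forall>x\<in>X - X0. \<forall>y\<in>X - X0. f x = f y \<longleftrightarrow> g (h x) = g (h y))"
      using fin by (intro psubset.IH) auto
    then obtain h where h: "bij_betw h (X - X0) (Y - Y0)"
      "\<And>x y. x \<in> X - X0 \<Longrightarrow> y \<in> X - X0 \<Longrightarrow> f x = f y \<longleftrightarrow> g (h x) = g (h y)"
      by blast
    obtain h0 where h0: "bij_betw h0 X0 Y0"
      using finite_same_card_bij[OF fin(1) cY0(2)] cY0 by auto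
    define h' where "h' x = (if x \<in> X0 then h0 x else h x)" for x
    have "bij_betw h' (X0 \<union> (X - X0)) (Y0 \<union> (Y - Y0))"
    proof (rule bij_betw_combine)
      show "bij_betw h' X0 Y0" using h0 by (simp add: h'_def cong: bij_betw_cong)
      show "bij_betw h' (X - X0) (Y - Y0)" using h(1)
        by (subst bij_betw_cong[where g = h]) (auto simp: h'_def)
    qed auto
    moreover have "X0 \<union> (X - X0) = X" "Y0 \<union> (Y - Y0) = Y" by (auto simp: X0_def Y0_def)
    ultimately have bij: "bij_betw h' X Y" by simp
    have in_Y0: "h' x \<in> Y0 \<longleftrightarrow> x \<in> X0" "h' x \<in> Y" if "x \<in> X" for x
      using that h0 h(1) by (auto simp: h'_def bij_betw_def Y0_def)
    have "f x = f y \<longleftrightarrow> g (h' x) = g (h' y)" if xy: "x \<in> X" "y \<in> X" for x y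
    proof (cases "x \<in> X0 \<or> y \<in> X0")
      case True
      then show ?thesis using in_Y0[of x] in_Y0[of y] xy by (auto simp: X0_def Y0_def)
    next
      case False
      then show ?thesis using h(2)[of x y] xy by (auto simp: h'_def)
    qed
    then show ?thesis using bij by blast
  qed
qed

text \<open>A matching carries the rows of a block bijectively onto its columns, so the blocks are
  square.\<close>

lemma card_fibre_rectangular:
  assumes "rectangular A R C" "s \<in> matchings A R C" "i \<in> R"
  shows "card {x \<in> R. A x \<inter> C = A i \<inter> C} = card (A i \<inter> C)"
proof (rule bij_betw_same_card)
  have s: "inj_on s R" "s ` R = C" and sA: "\<And>x. x \<in> R \<Longrightarrow> s x \<in> A x"
    using assms by (auto simp: matchings_def bij_betw_def)
  show "bij_betw s {x \<in> R. A x \<inter> C = A i \<inter> C} (A i \<inter> C)"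
    unfolding bij_betw_def
  proof
    show "inj_on s {x \<in> R. A x \<inter> C = A i \<inter> C}" using s by (auto simp: inj_on_def)
    show "s ` {x \<in> R. A x \<inter> C = A i \<inter> C} = A i \<inter> C"
    proof
      show "s ` {x \<in> R. A x \<inter> C = A i \<inter> C} \<subseteq> A i \<inter> C" using s sA by blast
      show "A i \<inter> C \<subseteq> s ` {x \<in> R. A x \<inter> C = A i \<inter> C}"
      proof
        fix c assume c: "c \<in> A i \<inter> C"
        then obtain x where "x \<in> R" "c = s x" using s by auto
        moreover from this have "A x \<inter> C = A i \<inter> C"
          using rectangular_mem_iff[OF assms(1) _ assms(3) sA, of x] c by simp
        ultimately show "c \<in> s ` {x \<in> R. A x \<inter> C = A i \<inter> C}" by blast
      qed
    qed
  qed
qed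

text \<open>Since blocks are square, the distribution of row sums is that of block heights, and
  \<open>bij_betw_fibre_card\<close> pairs the rows block by block.\<close>

lemma rectangular_isomorphic:
  assumes "finite R" "finite R'"
    and A: "rectangular A R C" "s \<in> matchings A R C"
    and B: "rectangular B R' C'" "t \<in> matchings B R' C'"
    and dist: "\<And>c. card {i \<in> R. card (A i \<inter> C) = c} = card {i \<in> R'. card (B i \<inter> C') = c}"
  shows "\<exists>p q. bij_betw p R R' \<and> bij_betw q C C' \<and> (\<forall>i\<in>R. \<forall>j\<in>C. j \<in> A i \<longleftrightarrow> q j \<in> B (p i))"
proof -
  have "{i \<in> R. card {x \<in> R. A x \<inter> C = A i \<inter> C} = c} = {i \<in> R. card (A i \<inter> C) = c}"
    "{i \<in> R'. card {x \<in> R'. B x \<inter> C' = B i \<inter> C'} = c} = {i \<in> R'. card (B i \<inter> C') = c}" for c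
    using card_fibre_rectangular[OF A] card_fibre_rectangular[OF B] by auto
  then have "\<exists>p. bij_betw p R R' \<and> (\<forall>x\<in>R. \<forall>y\<in>R. A x \<inter> C = A y \<inter> C
      \<longleftrightarrow> B (p x) \<inter> C' = B (p y) \<inter> C')"
    by (intro bij_betw_fibre_card) (use assms in auto)
  then obtain p where p: "bij_betw p R R'"
    "\<And>x y. x \<in> R \<Longrightarrow> y \<in> R \<Longrightarrow> A x \<inter> C = A y \<inter> C \<longleftrightarrow> B (p x) \<inter> C' = B (p y) \<inter> C'"
    by blast
  have s: "bij_betw s R C" "\<And>x. x \<in> R \<Longrightarrow> s x \<in> A x"
    and t: "bij_betw t R' C'" "\<And>x. x \<in> R' \<Longrightarrow> t x \<in> B x"
    using A B by (auto simp: matchings_def)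
  \<comment> \<open>The columns follow the rows: go back along \<open>s\<close>, across by
    \<open>p\<close>, and out along \<open>t\<close>. This preserves blocks because matchings
    do.\<close>
  define q where "q = t \<circ> p \<circ> inv_into R s"
  have q: "bij_betw q C C'"
    unfolding q_def by (intro bij_betw_trans[OF bij_betw_inv_into[OF s(1)]] bij_betw_trans[OF p(1)] t(1))
  have "j \<in> A i \<longleftrightarrow> q j \<in> B (p i)" if ij: "i \<in> R" "j \<in> C" for i j
  proof -
    obtain x where x: "x \<in> R" "j = s x" using s ij by (auto simp: bij_betw_def)
    have qj: "q j = t (p x)" using x s by (simp add: q_def bij_betw_def)
    have px: "p x \<in> R'" "p i \<in> R'" using p x ij by (auto simp: bij_betw_def)
    then have tC: "t (p x) \<in> C'" using t by (auto simp: bij_betw_def)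
    have "j \<in> A i \<longleftrightarrow> A x \<inter> C = A i \<inter> C"
      using rectangular_mem_iff[OF A(1) x(1) ij(1)] s(2)[OF x(1)] x ij by simp
    also have "\<dots> \<longleftrightarrow> B (p x) \<inter> C' = B (p i) \<inter> C'" by (rule p(2)[OF x(1) ij(1)])
    also have "\<dots> \<longleftrightarrow> t (p x) \<in> B (p i)"
      using rectangular_mem_iff[OF B(1) px] t(2)[OF px(1)] tC by simp
    finally show ?thesis using qj by simp
  qed
  then show ?thesis using p(1) q by blast
qed

section \<open>Direct sums of all-ones matrices\<close>

text \<open>The columns of the ones in row \<open>i\<close> of the direct sum of all-ones blocks of
  sizes \<open>ms\<close>. The recursion copies that of \<open>diag_block_mat\<close>; a row out of
  range gets the empty set.\<close>

fun block_row :: "nat list \<Rightarrow> nat \<Rightarrow> nat set" where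
  "block_row [] i = {}"
| "block_row (m # ms) i = (if i < m then {..<m} else (+) m ` block_row ms (i - m))"

lemma all_ones_mat_simps [simp]:
  "dim_row (all_ones_mat m) = m" "dim_col (all_ones_mat m) = m"
  "i < m \<Longrightarrow> j < m \<Longrightarrow> all_ones_mat m $$ (i, j) = 1"
  by (simp_all add: all_ones_mat_def)

lemma diag_block_all_ones_carrier:
  "diag_block_mat (map all_ones_mat ms) \<in> carrier_mat (sum_list ms) (sum_list ms)"
  by (rule carrier_matI) (simp_all add: dim_diag_block_mat o_def)

lemma index_diag_block_all_ones:
  assumes "i < sum_list ms" "j < sum_list ms"
  shows "diag_block_mat (map all_ones_mat ms) $$ (i, j) = (if j \<in> block_row ms i then 1 else 0 :: 'a :: {zero, one})"
  using assms
proof (induction ms arbitrary: i j)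
  case (Cons m ms)
  let ?D = "diag_block_mat (map all_ones_mat ms) :: 'a mat"
  have D: "dim_row ?D = sum_list ms" "dim_col ?D = sum_list ms"
    using diag_block_all_ones_carrier[of ms, where 'a = 'a] by auto
  show ?case
  proof (cases "i < m")
    case True
    then show ?thesis using Cons.prems D by (auto simp: Let_def)
  next
    case False
    have "(\<exists>x\<in>S. j = m + x) \<longleftrightarrow> m \<le> j \<and> j - m \<in> S" for S
      by (metis add_diff_cancel_left' le_add1 le_add_diff_inverse)
    then have mem: "j \<in> block_row (m # ms) i \<longleftrightarrow> m \<le> j \<and> j - m \<in> block_row ms (i - m)"
      using False by (auto simp: image_iff)
    have "diag_block_mat (map all_ones_mat (m # ms)) $$ (i, j)
        = (if j < m then 0 else ?D $$ (i - m, j - m))"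
      using False Cons.prems D by (simp add: Let_def)
    moreover have "\<not> j < m \<Longrightarrow> ?D $$ (i - m, j - m) = (if j - m \<in> block_row ms (i - m) then 1 else 0)"
      by (rule Cons.IH) (use False Cons.prems in auto)
    ultimately show ?thesis unfolding mem by auto
  qed
qed simp

lemma block_row_subset: "block_row ms i \<subseteq> {..<sum_list ms}"
proof (induction ms arbitrary: i)
  case (Cons m ms)
  have "m + j < m + sum_list ms" if "j \<in> block_row ms (i - m)" for j
    using subsetD[OF Cons.IH that] by simp
  then show ?case by auto
qed simp

text \<open>The diagonal runs inside the blocks, so the identity will serve as a matching.\<close>

lemma mem_block_row_self: "i < sum_list ms \<Longrightarrow> i \<in> block_row ms i"
proof (induction ms arbitrary: i)
  case (Cons m ms)
  then have "\<not> i < m \<Longrightarrow> m + (i - m) \<in> (+) m ` block_row ms (i - m)"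
    using Cons.IH[of "i - m"] by (intro imageI) auto
  then show ?case by simp
qed simp

lemma card_block_row: "i < sum_list ms \<Longrightarrow> card (block_row ms i) \<in> set ms"
proof (induction ms arbitrary: i)
  case (Cons m ms)
  then show ?case using Cons.IH[of "i - m"] by (auto simp: card_image)
qed simp

lemma block_row_eq:
  assumes "k \<in> block_row ms i" "k \<in> block_row ms j"
  shows "block_row ms i = block_row ms j"
  using assms
proof (induction ms arbitrary: i j k)
  case (Cons m ms)
  show ?case
  proof (cases "k < m")
    case True
    then show ?thesis using Cons.prems by (auto split: if_splits)
  next
    case False
    then have "i \<ge> m" "j \<ge> m" "k - m \<in> block_row ms (i - m)" "k - m \<in> block_row ms (j - m)"
      using Cons.prems by (auto split: if_splits)
    then show ?thesis using Cons.IH[of "k - m" "i - m" "j - m"] by simp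
  qed
qed simp

lemma sum_card_block_row: "(\<Sum>i<sum_list ms. card (block_row ms i)) = (\<Sum>m\<leftarrow>ms. m * m)"
proof (induction ms)
  case (Cons m ms)
  have "(\<Sum>i<m + sum_list ms. card (block_row (m # ms) i))
      = (\<Sum>i<m. card (block_row (m # ms) i)) + (\<Sum>i=m..<m + sum_list ms. card (block_row (m # ms) i))"
    unfolding lessThan_atLeast0 by (rule sum.atLeastLessThan_concat[symmetric]) auto
  also have "(\<Sum>i=m..<m + sum_list ms. card (block_row (m # ms) i))
      = (\<Sum>i<sum_list ms. card (block_row (m # ms) (m + i)))"
    using sum.shift_bounds_nat_ivl[of "\<lambda>i. card (block_row (m # ms) i)" 0 m "sum_list ms"]
    by (simp add: lessThan_atLeast0 add.commute del: block_row.simps)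
  finally have "(\<Sum>i<m + sum_list ms. card (block_row (m # ms) i))
      = (\<Sum>i<m. card (block_row (m # ms) i)) + (\<Sum>i<sum_list ms. card (block_row (m # ms) (m + i)))" .
  then show ?case using Cons.IH by (simp add: card_image)
qed simp

lemma rectangular_block_row: "rectangular (block_row ms) R C"
  unfolding rectangular_def using block_row_eq by blast

section \<open>Permanents of zero-one matrices\<close>

text \<open>Bregman's bound followed by concavity, compared through logarithms; equality holds iff
  it holds in both. The balance conditions are written as sums to avoid truncated
  subtraction.\<close>

lemma card_matchings_balanced:
  assumes "finite R" "finite C" "1 \<le> k"
    and a: "(\<Sum>i\<in>R. card (A i \<inter> C)) = k * card R + a * (k + 1)"
    and b: "(k + 1) * card R = (\<Sum>i\<in>R. card (A i \<inter> C)) + b * k"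
  shows "card (matchings A R C) \<le> fact (k + 1) ^ a * fact k ^ b"
    and "card (matchings A R C) = fact (k + 1) ^ a * fact k ^ b
      \<longleftrightarrow> matchings A R C \<noteq> {} \<and> rectangular A R C \<and> (\<forall>i\<in>R. card (A i \<inter> C) \<in> {k, k + 1})"
proof -
  let ?P = "card (matchings A R C)" and ?V = "fact (k + 1) ^ a * fact k ^ b :: nat"
  have V: "?V > 0" by simp
  have "?P \<le> ?V \<and> (?P = ?V \<longleftrightarrow> matchings A R C \<noteq> {} \<and> rectangular A R C
    \<and> (\<forall>i\<in>R. card (A i \<inter> C) \<in> {k, k + 1}))"
  proof (cases "matchings A R C = {}")
    case True
    then show ?thesis using V by simp
  next
    case False
    then have P: "?P > 0" using assms finite_matchings[of R C A] by (simp add: card_gt_0_iff)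
    obtain s where "s \<in> matchings A R C" using False by auto
    then have "s i \<in> A i \<inter> C" if "i \<in> R" for i
      using that by (auto simp: matchings_def bij_betw_def)
    \<comment> \<open>The concavity estimates start at 1; a matching guarantees that no row is
      empty.\<close>
    then have rows: "1 \<le> card (A i \<inter> C)" if "i \<in> R" for i
      using that assms by (fastforce simp: Suc_le_eq card_gt_0_iff)
    have u: "real (\<Sum>i\<in>R. card (A i \<inter> C)) - k * card R = a * real (k + 1)"
      unfolding a by (simp add: algebra_simps)
    have v: "(k + 1) * card R - real (\<Sum>i\<in>R. card (A i \<inter> C)) = b * real k"
    proof -
      have "real ((k + 1) * card R) = real (\<Sum>i\<in>R. card (A i \<inter> C)) + b * real k"
        unfolding b by simp
      then show ?thesis by simp
    qed
    have "ln ?V = a * ln (fact (k + 1)) + b * ln (fact k)"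
      by (simp add: ln_mult ln_realpow del: fact_Suc)
    also have "\<dots> = (a * real (k + 1)) * log_root_fact (k + 1) + (b * real k) * log_root_fact k"
      by (simp only: mult.assoc mult_log_root_fact)
    finally have lnV: "ln ?V = (a * real (k + 1)) * log_root_fact (k + 1) + (b * real k) * log_root_fact k" .
    note breg = bregman[OF assms(1,2) False]
    note conc = sum_log_root_fact_le[where r = "\<lambda>i. card (A i \<inter> C)", OF assms(1,3) rows, unfolded u v, folded lnV]
    have "?P \<le> ?V \<longleftrightarrow> ln ?P \<le> ln ?V" "?P = ?V \<longleftrightarrow> ln ?P = ln ?V"
      using P V by (simp_all del: of_nat_mult of_nat_power of_nat_fact)
    moreover have "ln ?P \<le> ln ?V" using breg conc(1) by linarith
    moreover have "ln ?P = ln ?V \<longleftrightarrow> ln ?P = (\<Sum>i\<in>R. log_root_fact (card (A i \<inter> C)))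
        \<and> (\<Sum>i\<in>R. log_root_fact (card (A i \<inter> C))) = ln ?V"
      using breg conc(1) by linarith
    ultimately show ?thesis
      using False bregman_eq_iff[OF assms(1,2) False] conc(2) by simp
  qed
  then show "?P \<le> ?V" and "?P = ?V \<longleftrightarrow> matchings A R C \<noteq> {} \<and> rectangular A R C
    \<and> (\<forall>i\<in>R. card (A i \<inter> C) \<in> {k, k + 1})" by blast+
qed

text \<open>The number of terms and their total are two linear equations for the two multiplicities.
  Hence equal totals will give equal distributions of row sums.\<close>

lemma card_fibre_two_values:
  assumes "finite R" "\<And>i. i \<in> R \<Longrightarrow> r i \<in> {k, k + 1}"
  shows "card {i \<in> R. r i = c}
    = (if c = k + 1 then (\<Sum>i\<in>R. r i) - k * card R
       else if c = k then (k + 1) * card R - (\<Sum>i\<in>R. r i) else 0)"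
proof -
  let ?H = "{i \<in> R. r i = k + 1}" and ?L = "{i \<in> R. r i = k}"
  have R: "R = ?L \<union> ?H" using assms(2) by auto
  have "(\<Sum>i\<in>R. r i) = (\<Sum>i\<in>?L. r i) + (\<Sum>i\<in>?H. r i)"
    by (subst R, rule sum.union_disjoint) (use assms in auto)
  also have "\<dots> = k * card ?L + (k + 1) * card ?H" by simp
  finally have sum: "(\<Sum>i\<in>R. r i) = k * card ?L + (k + 1) * card ?H" .
  have card: "card R = card ?L + card ?H"
    by (subst R, rule card_Un_disjoint) (use assms in auto)
  consider "c = k + 1" | "c = k" | "c \<noteq> k" "c \<noteq> k + 1" by blast
  then show ?thesis
  proof cases
    case 3
    then have "{i \<in> R. r i = c} = {}" using assms(2) by auto
    then show ?thesis using 3 by (simp only: card.empty if_False)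
  qed (simp_all add: sum card algebra_simps)
qed

section \<open>From permanents to matchings\<close>

definition one_columns :: "'a::one mat \<Rightarrow> nat \<Rightarrow> nat set" where
  "one_columns A i = {j. j < dim_col A \<and> A $$ (i, j) = 1}"

text \<open>The two kinds of functions differ only outside \<open>S\<close>, where a permutation is
  the identity and a matching is \<open>undefined\<close>.\<close>

lemma card_permutes_eq_card_matchings:
  "card {\<phi>. \<phi> permutes S \<and> (\<forall>i\<in>S. \<phi> i \<in> A i)} = card (matchings A S S)"
proof (rule bij_betw_same_card[where f = "\<lambda>\<phi>. restrict \<phi> S"],
    rule bij_betw_byWitness[where f' = "\<lambda>s x. if x \<in> S then s x else x"])
  show "\<forall>\<phi>\<in>{\<phi>. \<phi> permutes S \<and> (\<forall>i\<in>S. \<phi> i \<in> A i)}. (\<lambda>x. if x \<in> S then restrict \<phi> S x else x) = \<phi>"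
    by (auto simp: fun_eq_iff permutes_def)
  show "\<forall>s\<in>matchings A S S. restrict (\<lambda>x. if x \<in> S then s x else x) S = s"
    by (auto simp: matchings_def fun_eq_iff extensional_def)
  show "(\<lambda>\<phi>. restrict \<phi> S) ` {\<phi>. \<phi> permutes S \<and> (\<forall>i\<in>S. \<phi> i \<in> A i)} \<subseteq> matchings A S S"
  proof (intro image_subsetI)
    fix \<phi> assume "\<phi> \<in> {\<phi>. \<phi> permutes S \<and> (\<forall>i\<in>S. \<phi> i \<in> A i)}"
    moreover have "bij_betw (restrict \<phi> S) S S = bij_betw \<phi> S S" by (rule bij_betw_cong) simp
    ultimately show "restrict \<phi> S \<in> matchings A S S"
      by (auto simp: matchings_def permutes_imp_bij)
  qed
  show "(\<lambda>s x. if x \<in> S then s x else x) ` matchings A S S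
      \<subseteq> {\<phi>. \<phi> permutes S \<and> (\<forall>i\<in>S. \<phi> i \<in> A i)}"
  proof (intro image_subsetI)
    fix s assume s: "s \<in> matchings A S S"
    have "bij_betw (\<lambda>x. if x \<in> S then s x else x) S S = bij_betw s S S" by (rule bij_betw_cong) simp
    then have "(\<lambda>x. if x \<in> S then s x else x) permutes S"
      using s by (intro bij_imp_permutes) (auto simp: matchings_def)
    then show "(\<lambda>x. if x \<in> S then s x else x) \<in> {\<phi>. \<phi> permutes S \<and> (\<forall>i\<in>S. \<phi> i \<in> A i)}"
      using s by (auto simp: matchings_def)
  qed
qed

lemma permanent_eq_card_matchings:
  fixes A :: "'a :: comm_semiring_1 mat"
  assumes A: "A \<in> carrier_mat n n" and "elements_mat A \<subseteq> {0, 1}"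
  shows "permanent A = of_nat (card (matchings (one_columns A) {0..<n} {0..<n}))"
proof -
  have entry: "A $$ (i, j) \<in> {0, 1}" if "i < n" "j < n" for i j
    using assms(2) elements_matI[OF A that refl] by blast
  have prod: "(\<Prod>i = 0..<n. A $$ (i, \<phi> i)) = (if \<forall>i\<in>{0..<n}. \<phi> i \<in> one_columns A i then 1 else 0)"
    if "\<phi> permutes {0..<n}" for \<phi>
  proof -
    have \<phi>: "\<phi> i < n" if "i < n" for i
      using permutes_in_image[OF \<open>\<phi> permutes {0..<n}\<close>, of i] that by simp
    show ?thesis
    proof (cases "\<forall>i\<in>{0..<n}. \<phi> i \<in> one_columns A i")
      case True
      then have "A $$ (i, \<phi> i) = 1" if "i \<in> {0..<n}" for i using that by (auto simp: one_columns_def)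
      then have "(\<Prod>i = 0..<n. A $$ (i, \<phi> i)) = 1" by (rule prod.neutral[OF ballI])
      then show ?thesis using True by simp
    next
      case False
      then obtain i where i: "i \<in> {0..<n}" "\<phi> i \<notin> one_columns A i" by blast
      then have "A $$ (i, \<phi> i) = 0" using entry[of i "\<phi> i"] \<phi>[of i] A by (auto simp: one_columns_def)
      then have "(\<Prod>i = 0..<n. A $$ (i, \<phi> i)) = 0" using i(1) by (intro prod_zero) auto
      then show ?thesis using False by simp
    qed
  qed
  have "permanent A = (\<Sum>\<phi> | \<phi> permutes {0..<n}. if \<forall>i\<in>{0..<n}. \<phi> i \<in> one_columns A i then 1 else 0)"
    unfolding permanent_def using A prod by (intro sum.cong) auto
  also have "\<dots> = of_nat (card {\<phi>. \<phi> permutes {0..<n} \<and> (\<forall>i\<in>{0..<n}. \<phi> i \<in> one_columns A i)})"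
    by (simp add: finite_permutations flip: sum.inter_filter)
  finally show ?thesis unfolding card_permutes_eq_card_matchings .
qed

section \<open>Permuting rows and columns\<close>

lemma permanent_permute:
  assumes A: "A \<in> carrier_mat n n" and p: "p permutes {0..<n}" and q: "q permutes {0..<n}"
  shows "permanent (mat n n (\<lambda>(i, j). A $$ (p i, q j))) = permanent A"
proof -
  let ?S = "{\<phi>. \<phi> permutes {0..<n}}"
  have "permanent (mat n n (\<lambda>(i, j). A $$ (p i, q j)))
      = (\<Sum>\<phi>\<in>?S. \<Prod>i = 0..<n. A $$ (p i, q (\<phi> i)))"
    unfolding permanent_def
  proof (simp only: dim_row_mat, intro sum.cong prod.cong refl)
    fix \<phi> i assume "\<phi> \<in> ?S" "i \<in> {0..<n}"
    then have "i < n" "\<phi> i < n" using permutes_in_image[of \<phi> "{0..<n}" i] by auto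
    then show "mat n n (\<lambda>(i, j). A $$ (p i, q j)) $$ (i, \<phi> i) = A $$ (p i, q (\<phi> i))" by simp
  qed
  \<comment> \<open>Reindexing the product moves \<open>p\<close> to the column argument as its
    inverse. Composition with \<open>q\<close> on the left and with this inverse on the right then
    only rearranges the sum over permutations.\<close>
  also have "\<dots> = (\<Sum>\<phi>\<in>?S. \<Prod>i = 0..<n. A $$ (i, (q \<circ> \<phi> \<circ> inv_into UNIV p) i))"
    by (intro sum.cong refl, subst prod.permute[OF p])
      (simp add: o_def permutes_inverses(2)[OF p])
  also have "\<dots> = (\<Sum>\<phi>\<in>?S. \<Prod>i = 0..<n. A $$ (i, (\<phi> \<circ> inv_into UNIV p) i))"
    by (rule setum_permutations_compose_left[OF q, symmetric,
        of "\<lambda>\<phi>. \<Prod>i = 0..<n. A $$ (i, (\<phi> \<circ> inv_into UNIV p) i)"])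
  also have "\<dots> = (\<Sum>\<phi>\<in>?S. \<Prod>i = 0..<n. A $$ (i, \<phi> i))"
    by (rule sum_permutations_compose_right[OF permutes_inv[OF p], symmetric])
  also have "\<dots> = permanent A" using A by (simp add: permanent_def)
  finally show ?thesis .
qed

text \<open>On the right, column \<open>j\<close> of the permutation matrix has its one in row
  \<open>inv_into UNIV q j\<close>, hence the inverse there and not on the left.\<close>

lemma permutation_mat_mult:
  fixes A :: "'a :: semiring_1 mat"
  assumes A: "A \<in> carrier_mat n n" and p: "p permutes {0..<n}" and q: "q permutes {0..<n}"
  shows "permutation_mat n p * A * permutation_mat n q = mat n n (\<lambda>(i, j). A $$ (p i, inv_into UNIV q j))"
proof (rule eq_matI)
  fix i j assume "i < dim_row (mat n n (\<lambda>(i, j). A $$ (p i, inv_into UNIV q j)))"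
    "j < dim_col (mat n n (\<lambda>(i, j). A $$ (p i, inv_into UNIV q j)))"
  then have ij: "i < n" "j < n" by auto
  have pi: "p i < n" using ij permutes_in_image[OF p, of i] by simp
  have qj: "inv_into UNIV q j < n" using ij permutes_in_image[OF permutes_inv[OF q], of j] by simp
  have q_eq: "j = q l \<longleftrightarrow> l = inv_into UNIV q j" for l
    using permutes_inv_eq[OF q, of j l] by auto
  have left: "(permutation_mat n p * A) $$ (i, l) = A $$ (p i, l)" if "l < n" for l
  proof -
    have "(permutation_mat n p * A) $$ (i, l)
        = (\<Sum>m = 0..<n. (if m = p i then 1 else 0) * A $$ (m, l))"
      using A ij that by (simp add: permutation_mat_def scalar_prod_def)
    also have "\<dots> = (\<Sum>m = 0..<n. if m = p i then A $$ (m, l) else 0)"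
      by (intro sum.cong) auto
    also have "\<dots> = A $$ (p i, l)" using pi by simp
    finally show ?thesis .
  qed
  have "(permutation_mat n p * A * permutation_mat n q) $$ (i, j)
      = (\<Sum>l = 0..<n. (permutation_mat n p * A) $$ (i, l) * (if j = q l then 1 else 0))"
    using A ij by (simp add: permutation_mat_def scalar_prod_def)
  also have "\<dots> = (\<Sum>l = 0..<n. if l = inv_into UNIV q j then A $$ (p i, l) else 0)"
    by (intro sum.cong) (simp_all add: left q_eq)
  also have "\<dots> = A $$ (p i, inv_into UNIV q j)" using qj by simp
  finally show "(permutation_mat n p * A * permutation_mat n q) $$ (i, j)
      = mat n n (\<lambda>(i, j). A $$ (p i, inv_into UNIV q j)) $$ (i, j)"
    using ij by simp
qed (simp_all add: permutation_mat_def)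

lemma comb_equivalent_iff:
  assumes A: "A \<in> carrier_mat n n"
  shows "comb_equivalent A B \<longleftrightarrow> (\<exists>p q. p permutes {0..<n} \<and> q permutes {0..<n}
    \<and> B = mat n n (\<lambda>(i, j). A $$ (p i, q j)))"
proof
  assume "comb_equivalent A B"
  then obtain p q where "p permutes {0..<n}" "q permutes {0..<n}"
    "B = permutation_mat n p * A * permutation_mat n q"
    using A by (auto simp: comb_equivalent_def is_permutation_mat_def)
  then show "\<exists>p q. p permutes {0..<n} \<and> q permutes {0..<n} \<and> B = mat n n (\<lambda>(i, j). A $$ (p i, q j))"
    using permutation_mat_mult[OF A] permutes_inv by blast
next
  assume "\<exists>p q. p permutes {0..<n} \<and> q permutes {0..<n} \<and> B = mat n n (\<lambda>(i, j). A $$ (p i, q j))"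
  then obtain p q where pq: "p permutes {0..<n}" "q permutes {0..<n}"
    and B: "B = mat n n (\<lambda>(i, j). A $$ (p i, q j))" by blast
  have "B = permutation_mat n p * A * permutation_mat n (inv_into UNIV q)"
    using permutation_mat_mult[OF A pq(1) permutes_inv[OF pq(2)]] pq by (simp add: B permutes_inv_inv)
  then show "comb_equivalent A B"
    using A pq permutes_inv[OF pq(2)] by (auto simp: comb_equivalent_def is_permutation_mat_def)
qed

lemma comb_equivalent_permanent:
  "A \<in> carrier_mat n n \<Longrightarrow> comb_equivalent A B \<Longrightarrow> permanent B = permanent A"
  by (auto simp: comb_equivalent_iff permanent_permute)

lemma card_zeros:
  fixes A :: "int mat"
  assumes A: "A \<in> carrier_mat n n" and "elements_mat A \<subseteq> {0, 1}"
  shows "int (card {(i, j). i < n \<and> j < n \<and> A $$ (i, j) = 0})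
    = (int n)\<^sup>2 - int (\<Sum>i = 0..<n. card (one_columns A i))"
proof -
  have entry: "A $$ (i, j) \<in> {0, 1}" if "i < n" "j < n" for i j
    using assms(2) elements_matI[OF A that refl] by blast
  have sub: "one_columns A i \<subseteq> {0..<n}" for i using A by (auto simp: one_columns_def)
  have le: "card (one_columns A i) \<le> n" for i using card_mono[OF _ sub] by simp
  have "{(i, j). i < n \<and> j < n \<and> A $$ (i, j) = 0} = (SIGMA i:{0..<n}. {0..<n} - one_columns A i)"
    using A entry by (fastforce simp: one_columns_def)
  then have "card {(i, j). i < n \<and> j < n \<and> A $$ (i, j) = 0}
      = (\<Sum>i = 0..<n. card ({0..<n} - one_columns A i))" by simp
  also have "\<dots> = (\<Sum>i = 0..<n. n - card (one_columns A i))"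
    using card_Diff_subset[OF finite_subset[OF sub finite_atLeastLessThan] sub] by simp
  also have "int \<dots> = (int n)\<^sup>2 - int (\<Sum>i = 0..<n. card (one_columns A i))"
    using le by (simp add: of_nat_diff sum_subtractf power2_eq_square)
  finally show ?thesis .
qed

section \<open>The maximal permanent and the matrices attaining it\<close>

theorem theorem1p5:
  fixes n k :: nat and \<tau> \<sigma> :: int
  assumes "n \<ge> 3"
    and "\<sigma> = (int n)\<^sup>2 - \<tau>"
    and "k \<ge> 1"
    and "int k * int n \<le> \<sigma>" and "\<sigma> \<le> (int k + 1) * int n"
    and "[\<sigma> - int k * int n = 0] (mod (int k + 1))"
    and "[(int k + 1) * int n - \<sigma> = 0] (mod (int k))"
  shows "max_permanent n \<tau> =
           fact (k + 1) ^ nat ((\<sigma> - int k * int n) div (int k + 1)) *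
           fact k ^ nat (((int k + 1) * int n - \<sigma>) div int k)
         \<and> block_ones_mat n \<sigma> k \<in> zero_one_mats n \<tau>
         \<and> (\<forall>A \<in> zero_one_mats n \<tau>.
              permanent A = max_permanent n \<tau> \<longleftrightarrow> comb_equivalent A (block_ones_mat n \<sigma> k))"
proof -
  define a b where "a = nat ((\<sigma> - int k * int n) div (int k + 1))"
    and "b = nat (((int k + 1) * int n - \<sigma>) div int k)"
  define V :: nat where "V = fact (k + 1) ^ a * fact k ^ b"
  define K where "K = block_ones_mat n \<sigma> k"
  define ms where "ms = replicate a (k + 1) @ replicate b k"
  \<comment> \<open>The congruences make the quotients exact and the bounds on
    \<open>\<sigma>\<close> make them nonnegative, so neither \<open>div\<close> nor
    \<open>nat\<close> loses anything.\<close>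
  have a: "\<sigma> - int k * int n = int a * (int k + 1)"
    using assms(4,6) by (auto simp: a_def cong_0_iff pos_imp_zdiv_nonneg_iff)
  have b: "(int k + 1) * int n - \<sigma> = int b * int k"
    using assms(3,5,7) by (auto simp: b_def cong_0_iff pos_imp_zdiv_nonneg_iff)
  \<comment> \<open>Adding the two equations eliminates \<open>\<sigma>\<close>: the block sizes add
    up to \<open>n\<close>.\<close>
  have "int n = int (a * (k + 1) + b * k)" using a b by (simp add: algebra_simps)
  then have n: "n = a * (k + 1) + b * k" by (rule of_nat_eq_iff[THEN iffD1])
  have ms: "sum_list ms = n" "set ms \<subseteq> {k, k + 1}"
    by (auto simp: ms_def n sum_list_replicate)
  have K_diag: "K = diag_block_mat (map all_ones_mat ms)"
    by (simp add: K_def block_ones_mat_def ms_def flip: a_def b_def)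
  have K: "K \<in> carrier_mat n n"
    using diag_block_all_ones_carrier[of ms] by (simp add: K_diag ms)
  have K_entry: "K $$ (i, j) = (if j \<in> block_row ms i then 1 else 0)" if "i < n" "j < n" for i j
    using index_diag_block_all_ones[of i ms j] that by (simp add: K_diag ms)
  have K01: "elements_mat K \<subseteq> {0, 1}"
  proof
    fix x assume "x \<in> elements_mat K"
    then obtain i j where "i < n" "j < n" "x = K $$ (i, j)" using K by auto
    then show "x \<in> {0, 1}" using K_entry[of i j] by simp
  qed
  have K_row: "one_columns K i = block_row ms i" if "i < n" for i
  proof (rule Set.set_eqI)
    fix j
    have "j < n" if "j \<in> block_row ms i" using subsetD[OF block_row_subset that] ms by simp
    then show "j \<in> one_columns K i \<longleftrightarrow> j \<in> block_row ms i"
      using K K_entry[OF that, of j] by (auto simp: one_columns_def split: if_splits)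
  qed
  have row_Int: "one_columns A i \<inter> {0..<n} = one_columns A i" if "A \<in> carrier_mat n n" for A :: "int mat" and i
    using that by (auto simp: one_columns_def)
  have K_sum: "int (\<Sum>i = 0..<n. card (one_columns K i)) = \<sigma>"
  proof -
    have "(\<Sum>i = 0..<n. card (one_columns K i)) = (\<Sum>i<n. card (block_row ms i))"
      unfolding lessThan_atLeast0 by (intro sum.cong refl) (simp add: K_row)
    also have "\<dots> = a * ((k + 1) * (k + 1)) + b * (k * k)"
      using sum_card_block_row[of ms] by (simp add: ms(1)) (simp add: ms_def sum_list_replicate)
    also have "int \<dots> = int k * int n + int a * (int k + 1)"
      by (simp add: n algebra_simps)
    finally show ?thesis using a by simp
  qed
  have sum_rows: "int (\<Sum>i = 0..<n. card (one_columns A i)) = \<sigma>" if "A \<in> zero_one_mats n \<tau>" for A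
    using card_zeros[of A n] that assms(2) by (auto simp: zero_one_mats_def)
  have K_mem: "K \<in> zero_one_mats n \<tau>"
    using card_zeros[OF K K01] K K01 K_sum assms(2) by (simp add: zero_one_mats_def)
  have bound: "permanent A \<le> int V"
    "permanent A = int V \<longleftrightarrow> matchings (one_columns A) {0..<n} {0..<n} \<noteq> {}
        \<and> rectangular (one_columns A) {0..<n} {0..<n} \<and> (\<forall>i\<in>{0..<n}. card (one_columns A i) \<in> {k, k + 1})"
    if A: "A \<in> zero_one_mats n \<tau>" for A
  proof -
    have A': "A \<in> carrier_mat n n" "elements_mat A \<subseteq> {0, 1}" using A by (auto simp: zero_one_mats_def)
    have "int (\<Sum>i = 0..<n. card (one_columns A i \<inter> {0..<n})) = int (k * card {0..<n} + a * (k + 1))"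
      using sum_rows[OF A] a by (simp add: row_Int[OF A'(1)] algebra_simps)
    then have 1: "(\<Sum>i = 0..<n. card (one_columns A i \<inter> {0..<n})) = k * card {0..<n} + a * (k + 1)"
      by (rule of_nat_eq_iff[THEN iffD1])
    have "int ((k + 1) * card {0..<n}) = int ((\<Sum>i = 0..<n. card (one_columns A i \<inter> {0..<n})) + b * k)"
      using sum_rows[OF A] b by (simp add: row_Int[OF A'(1)] algebra_simps)
    then have 2: "(k + 1) * card {0..<n} = (\<Sum>i = 0..<n. card (one_columns A i \<inter> {0..<n})) + b * k"
      by (rule of_nat_eq_iff[THEN iffD1])
    note bal = card_matchings_balanced[OF _ _ assms(3) 1 2, folded V_def, unfolded row_Int[OF A'(1)]]
    show "permanent A \<le> int V"
      "permanent A = int V \<longleftrightarrow> matchings (one_columns A) {0..<n} {0..<n} \<noteq> {}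
        \<and> rectangular (one_columns A) {0..<n} {0..<n} \<and> (\<forall>i\<in>{0..<n}. card (one_columns A i) \<in> {k, k + 1})"
      using bal by (simp_all add: permanent_eq_card_matchings[OF A'])
  qed
  \<comment> \<open>The identity, restricted so as to be extensional.\<close>
  define d where "d = restrict id {0..<n}"
  have "bij_betw d {0..<n} {0..<n} = bij_betw id {0..<n} {0..<n}"
    unfolding d_def by (rule bij_betw_cong) simp
  then have K_match: "d \<in> matchings (one_columns K) {0..<n} {0..<n}"
    using mem_block_row_self[of _ ms] ms(1) K_row by (auto simp: matchings_def d_def)
  have K_rect: "rectangular (one_columns K) {0..<n} {0..<n}"
    using rectangular_block_row[of ms "{0..<n}" "{0..<n}"] by (simp add: rectangular_def K_row)
  have K_card: "card (one_columns K i) \<in> {k, k + 1}" if "i \<in> {0..<n}" for i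
    using card_block_row[of i ms] that ms K_row[of i] by auto
  have K_per: "permanent K = int V"
    unfolding bound(2)[OF K_mem] using K_match K_rect K_card by blast
  have max: "max_permanent n \<tau> = int V"
    unfolding max_permanent_def
  proof (rule Max_eqI)
    \<comment> \<open>\<open>Max\<close> needs a finite set of values; integers between 0 and
      \<open>V\<close> provide it.\<close>
    have "permanent A \<in> {0..int V}" if "A \<in> zero_one_mats n \<tau>" for A
      using bound(1)[OF that] that by (auto simp: zero_one_mats_def permanent_eq_card_matchings)
    then show "finite (permanent ` zero_one_mats n \<tau>)"
      by (intro finite_subset[OF _ finite_atLeastAtMost_int[of 0 "int V"]]) blast
    show "x \<le> int V" if "x \<in> permanent ` zero_one_mats n \<tau>" for x using that bound(1) by blast
    show "int V \<in> permanent ` zero_one_mats n \<tau>" using K_mem K_per by force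
  qed
  have "comb_equivalent A K" if A: "A \<in> zero_one_mats n \<tau>" and per: "permanent A = int V" for A
  proof -
    have A': "A \<in> carrier_mat n n" "elements_mat A \<subseteq> {0, 1}" using A by (auto simp: zero_one_mats_def)
    obtain s where s: "s \<in> matchings (one_columns A) {0..<n} {0..<n}"
      and rect: "rectangular (one_columns A) {0..<n} {0..<n}"
      and rows: "\<And>i. i \<in> {0..<n} \<Longrightarrow> card (one_columns A i) \<in> {k, k + 1}"
      using per bound(2)[OF A] by blast
    have "(\<Sum>i = 0..<n. card (one_columns A i)) = (\<Sum>i = 0..<n. card (one_columns K i))"
      using sum_rows[OF A] K_sum by linarith
    \<comment> \<open>Both matrices have total \<open>\<sigma>\<close> and row sums in
      \<open>{k, k + 1}\<close>, so their row sums have the same distribution.\<close>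
    then have dist: "card {i \<in> {0..<n}. card (one_columns K i) = c} = card {i \<in> {0..<n}. card (one_columns A i) = c}" for c
      using card_fibre_two_values[of "{0..<n}" "\<lambda>i. card (one_columns A i)" k c, OF _ rows]
        card_fibre_two_values[of "{0..<n}" "\<lambda>i. card (one_columns K i)" k c, OF _ K_card] by simp
    \<comment> \<open>The isomorphism is taken from \<open>K\<close> to \<open>A\<close>, so that it
      expresses the entries of \<open>K\<close> by those of \<open>A\<close>, as
      \<open>comb_equivalent_iff\<close> asks.\<close>
    obtain p q where pq: "bij_betw p {0..<n} {0..<n}" "bij_betw q {0..<n} {0..<n}"
      and iso: "\<And>i j. i \<in> {0..<n} \<Longrightarrow> j \<in> {0..<n} \<Longrightarrow> j \<in> one_columns K i \<longleftrightarrow> q j \<in> one_columns A (p i)"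
      using rectangular_isomorphic[OF _ _ K_rect K_match rect s, unfolded row_Int[OF K] row_Int[OF A'(1)], OF _ _ dist]
      by blast
    define p' q' where "p' i = (if i \<in> {0..<n} then p i else i)"
      and "q' i = (if i \<in> {0..<n} then q i else i)" for i
    have "p' permutes {0..<n}" "q' permutes {0..<n}"
      using pq bij_betw_cong[of "{0..<n}" p' p] bij_betw_cong[of "{0..<n}" q' q]
      by (auto simp: p'_def q'_def intro!: bij_imp_permutes)
    moreover have "K = mat n n (\<lambda>(i, j). A $$ (p' i, q' j))"
    proof (rule eq_matI)
      fix i j assume "i < dim_row (mat n n (\<lambda>(i, j). A $$ (p' i, q' j)))"
        "j < dim_col (mat n n (\<lambda>(i, j). A $$ (p' i, q' j)))"
      then have ij: "i < n" "j < n" by auto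
      then have "p i < n" "q j < n" using pq by (auto simp: bij_betw_def)
      \<comment> \<open>The isomorphism only says where the ones are; for entries 0 and 1 this
        determines the matrix.\<close>
      then have "A $$ (p i, q j) \<in> {0, 1}" using A' elements_matI[OF A'(1)] by blast
      moreover have "K $$ (i, j) = 1 \<longleftrightarrow> A $$ (p i, q j) = 1"
        using iso[of i j] ij K A'(1) \<open>q j < n\<close> by (simp add: one_columns_def)
      ultimately show "K $$ (i, j) = mat n n (\<lambda>(i, j). A $$ (p' i, q' j)) $$ (i, j)"
        using ij K_entry[OF ij] by (auto simp: p'_def q'_def split: if_splits)
    qed (use K in auto)
    ultimately show ?thesis unfolding comb_equivalent_iff[OF A'(1)] by blast
  qed
  moreover have "permanent A = int V" if "A \<in> zero_one_mats n \<tau>" "comb_equivalent A K" for A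
    using comb_equivalent_permanent[of A n K] that K_per by (simp add: zero_one_mats_def)
  moreover have "int V = fact (k + 1) ^ a * fact k ^ b"
    by (simp only: V_def of_nat_mult of_nat_power of_nat_fact)
  ultimately show ?thesis
    using K_mem unfolding K_def[symmetric] a_def[symmetric] b_def[symmetric] max by auto
qed

end
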